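(* Let $f:\mathbb{R}^n\to\mathbb{R}$ be convex and continuously differentiable, with $|f(x)-f(y)|\le L_0\|x-y\|$ and $\|\nabla f(x)-\nabla f(y)\|\le L_1\|x-y\|$ for all $x,y$, and let $x^*$ be a minimizer of $f$ with $f^*=f(x^* )$. Let $\tilde f(x;\xi)=f(x)[1+\nu(x;\xi)]$, where $\nu$ is i.i.d. (across all evaluations) with $\mathbb{E}[\nu]=0$, variance $\sigma_r^2>0$, $\mathbb{E}[\frac{1}{1+\nu}]\le b$, and support in $[-a,a]$ for some $a<1$. Let $\{x_k\}_{k\ge0}$ be generated from $x_0$ by $$x_{k+1}=x_k-h\,\frac{\tilde f(x_k+\mu_k u_k;\xi_k)-\tilde f(x_k;\xi_{k-1})}{\mu_k}u_k,\qquad \mu_k=C_4\sqrt{|\tilde f(x_k;\xi_{k'})|},$$ where $u_0,u_1,\dots$ are independent standard Gaussian vectors independent of the noise, the three noisy evaluations at each iteration (indexed by $\xi_{k'},\xi_k,\xi_{k-1}$) have independent noise, $C_4=\left[\frac{16\sigma_r^2 n}{L_1^2(1+3\sigma_r^2)(n+6)^3}\right]^{1/4}$, and $h=\frac{1}{4L_1(n+4)}$ (assume $f(x_k)\neq0$ along the iterates, so that $\mu_k>0$). Let $\phi_0=f(x_0)$ and $\phi_k=\mathbb{E}[f(x_k)]$ for $k\ge1$, the expectation over all randomness used up to iteration $k-1$. Let $N\ge0$ and let $M$ satisfy $$M\ge\frac{1}{N+1}\Big(|f(x_0)|+\sum_{k=1}^N\mathbb{E}[|f(x_k)|]\Big).$$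 Then $$\frac{1}{N+1}\sum_{k=0}^N(\phi_k-f^* )\le\frac{4L_1(n+4)}{N+1}\|x_0-x^*\|^2+4L_1(n+4)(C_7M+C_8),$$ where $C_7=\frac{C_4^2 n}{4(n+4)}+\frac{C_5}{16L_1^2(n+4)^2}$, $C_8=\frac{C_6}{16L_1^2(n+4)^2}$, $C_5=\tfrac12C_4^2L_1^2(n+6)^3+(1+b)L_1\sigma_r\sqrt{(1+3\sigma_r^2)n(n+6)^3}$, and $C_6=3L_0^2\sigma_r^2(n+4)^2$.
   Context: $\|\cdot\|$ is the Euclidean norm; "standard Gaussian" means mean $0$ and covariance $I_n$. *)

theory Defs
  imports "HOL-Probability.Probability"
begin

definition ftilde :: "(real^'n \<Rightarrow> real) \<Rightarrow> real^'n \<Rightarrow> real \<Rightarrow> real" where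
  "ftilde f x v = f x * (1 + v)"

text \<open>Zeroth-order iteration. Iteration k uses the three fresh noise samples
  nu (3k) (for the smoothing parameter mu_k), nu (3k+1) (at x_k + mu_k u_k)
  and nu (3k+2) (at x_k), and the Gaussian direction u k.\<close>
definition zo_mu :: "(real^'n \<Rightarrow> real) \<Rightarrow> real \<Rightarrow> real^'n \<Rightarrow> real \<Rightarrow> real" where
  "zo_mu f C4 xk v = C4 * sqrt \<bar>ftilde f xk v\<bar>"

primrec zo_iter :: "(real^'n \<Rightarrow> real) \<Rightarrow> real \<Rightarrow> real \<Rightarrow> real^'n \<Rightarrow>
    (nat \<Rightarrow> 'w \<Rightarrow> real^'n) \<Rightarrow> (nat \<Rightarrow> 'w \<Rightarrow> real) \<Rightarrow> nat \<Rightarrow> 'w \<Rightarrow> real^'n" where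
  "zo_iter f h C4 x0 u nu 0 \<omega> = x0"
| "zo_iter f h C4 x0 u nu (Suc k) \<omega> =
    (let xk = zo_iter f h C4 x0 u nu k \<omega>;
         mu = zo_mu f C4 xk (nu (3*k) \<omega>)
     in xk - (h * (ftilde f (xk + mu *\<^sub>R u k \<omega>) (nu (3*k+1) \<omega>)
                   - ftilde f xk (nu (3*k+2) \<omega>)) / mu) *\<^sub>R u k \<omega>)"

end

theory Submission
  imports Defs "HOL-Real_Asymp.Real_Asymp"
begin

text \<open>
  Fix the current point \<open>x\<close> and the smoothing radius \<open>\<mu>\<close>, and average the squared distance to
  \<open>x\<^sup>*\<close> after one step over the fresh direction and noise. Stein's identity turns the linear term
  into \<open>E \<langle>\<nabla>f(x + \<mu>u), x - x\<^sup>*\<rangle>\<close>, which by convexity and smoothness is at least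
  \<open>f(x) - f\<^sup>* - L\<^sub>1\<mu>\<^sup>2n/2\<close>. The quadratic term is bounded by Gaussian moments (also computed by Stein's
  identity, through Euler's relation for homogeneous functions), and its \<open>\<parallel>\<nabla>f(x)\<parallel>\<^sup>2\<close> part is absorbed
  because \<open>\<parallel>\<nabla>f(x)\<parallel>\<^sup>2 \<le> 2L\<^sub>1(f(x) - f\<^sup>*)\<close>. With \<open>\<mu>\<^sup>2\<close> proportional to the noisy value
  \<open>|f(x)|(1 + \<nu>)\<close>, the remaining terms in \<open>\<mu>\<^sup>2\<close> and \<open>f(x)\<^sup>2/\<mu>\<^sup>2\<close> average to multiples of \<open>|f(x)|\<close>,
  and the resulting one-step inequality telescopes.
\<close>

subsection \<open>Smooth convex functions\<close>

text \<open>Two obstacles shape the argument. The radius in step k is itself random: it depends on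
  the iterate and on the sample \<open>nu (3*k)\<close>. And no second moment of the iterates is
  given. So a step is conditioned on the past together with that one sample, which freezes both the
  iterate and the radius; this is done with nonnegative integrals, and square integrability of the
  distance is carried along in the induction. The value of \<open>h\<close> gives
  \<open>4 * L1 * (n + 2) * h \<le> 1\<close>, so absorbing the gradient costs half of the decrease
  \<open>2 * h * (f x - f z)\<close>. The remaining \<open>h\<close> explains the prefactor
  \<open>4 * L1 * (n + 4)\<close>, which is \<open>1 / h\<close>. Noise contributes a multiple of
  \<open>f(x)^2 / \<mu>^2\<close>, which blows up as the radius shrinks, while smoothing contributes
  a multiple of \<open>\<mu>^2\<close>. Taking \<open>\<mu>^2\<close> of order \<open>|f x|\<close>
  makes both linear in \<open>|f x|\<close>. The fourth root balances the coefficients: with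
  \<open>q = sqrt ((1 + 3 \<sigma>^2) n (n + 6)^3)\<close> it yields
  \<open>C4^2 = 4 \<sigma> n / (L1 q)\<close>, so the second-order remainder and the noise term are
  both multiples of \<open>L1 \<sigma> q\<close>, up to factors depending on \<open>\<sigma>\<close>
  and \<open>b\<close>.\<close>

lemma gradient_lipschitz_upper:
  fixes f :: "'a::real_inner \<Rightarrow> real"
  assumes grad: "\<And>x. (f has_derivative (\<lambda>d. g x \<bullet> d)) (at x)"
    and lip: "\<And>x y. norm (g x - g y) \<le> L * norm (x - y)"
  shows "f (x + d) \<le> f x + g x \<bullet> d + L / 2 * (norm d)\<^sup>2"
proof -
  \<comment> \<open>\<open>p\<close> is \<open>f\<close> along the segment minus the nonconstant
    part of the claimed quadratic majorant. Cauchy-Schwarz and the Lipschitz gradient make its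
    derivative nonpositive for \<open>t \<ge> 0\<close>, so comparing \<open>t = 1\<close> with
    \<open>t = 0\<close> suffices.\<close>
  define p where "p t = f (x + t *\<^sub>R d) - t * (g x \<bullet> d) - L * t\<^sup>2 / 2 * (norm d)\<^sup>2" for t
  have "(p has_real_derivative ((g (x + t *\<^sub>R d) - g x) \<bullet> d - L * t * (norm d)\<^sup>2)) (at t)" for t
  proof -
    have "((\<lambda>t. f (x + t *\<^sub>R d)) has_derivative (\<lambda>s. g (x + t *\<^sub>R d) \<bullet> (s *\<^sub>R d))) (at t)"
      by (rule has_derivative_compose[OF _ grad]) (auto intro!: derivative_eq_intros)
    then have [derivative_intros]:
      "((\<lambda>t. f (x + t *\<^sub>R d)) has_real_derivative g (x + t *\<^sub>R d) \<bullet> d) (at t)"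
      unfolding has_field_derivative_def by (simp add: mult.commute[of _ "_ \<bullet> _"])
    show ?thesis
      unfolding p_def by (auto intro!: derivative_eq_intros simp: inner_diff_left)
  qed
  moreover have "(g (x + t *\<^sub>R d) - g x) \<bullet> d - L * t * (norm d)\<^sup>2 \<le> 0" if "0 \<le> t" for t
  proof -
    have "(g (x + t *\<^sub>R d) - g x) \<bullet> d \<le> norm (g (x + t *\<^sub>R d) - g x) * norm d"
      by (rule norm_cauchy_schwarz)
    also have "\<dots> \<le> (L * norm (t *\<^sub>R d)) * norm d"
      using lip[of "x + t *\<^sub>R d" x] by (intro mult_right_mono) auto
    finally show ?thesis using that by (simp add: power2_eq_square)
  qed
  ultimately have "p 1 \<le> p 0"
    by (intro DERIV_nonpos_imp_nonincreasing[of 0 1 p]) (auto intro!: exI)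
  then show ?thesis by (simp add: p_def)
qed

lemma gradient_lipschitz_lower:
  fixes f :: "'a::real_inner \<Rightarrow> real"
  assumes grad: "\<And>x. (f has_derivative (\<lambda>d. g x \<bullet> d)) (at x)"
    and lip: "\<And>x y. norm (g x - g y) \<le> L * norm (x - y)"
  shows "f x + g x \<bullet> d - L / 2 * (norm d)\<^sup>2 \<le> f (x + d)"
proof -
  have "- f (x + d) \<le> - f x + - g x \<bullet> d + L / 2 * (norm d)\<^sup>2"
  proof (rule gradient_lipschitz_upper[where f = "\<lambda>x. - f x" and g = "\<lambda>x. - g x"])
    show "((\<lambda>x. - f x) has_derivative (\<lambda>d. - g x \<bullet> d)) (at x)" for x
      by (auto intro!: derivative_eq_intros grad)
    show "norm (- g x - - g y) \<le> L * norm (x - y)" for x y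
      using lip[of y x] by (simp add: norm_minus_commute)
  qed
  then show ?thesis by simp
qed

text \<open>The displacement \<open>- g x / L\<close> minimizes the quadratic majorant at
  \<open>x\<close> and lowers it by \<open>|g x|^2 / (2 L)\<close>; the value reached is still at
  least \<open>m\<close>.\<close>

lemma norm_gradient_le_gap:
  fixes f :: "'a::real_inner \<Rightarrow> real"
  assumes grad: "\<And>x. (f has_derivative (\<lambda>d. g x \<bullet> d)) (at x)"
    and lip: "\<And>x y. norm (g x - g y) \<le> L * norm (x - y)"
    and L: "L > 0" and min: "\<And>x. m \<le> f x"
  shows "(norm (g x))\<^sup>2 \<le> 2 * L * (f x - m)"
proof -
  have "m \<le> f (x + (- 1 / L) *\<^sub>R g x)" by (rule min)
  also have "\<dots> \<le> f x + g x \<bullet> ((- 1 / L) *\<^sub>R g x) + L / 2 * (norm ((- 1 / L) *\<^sub>R g x))\<^sup>2"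
    by (rule gradient_lipschitz_upper[OF grad lip])
  also have "\<dots> = f x - (norm (g x))\<^sup>2 / (2 * L)"
    using L by (simp add: power2_norm_eq_inner power_mult_distrib field_simps)
      (simp add: power2_eq_square)
  finally show ?thesis using L by (simp add: field_simps)
qed

text \<open>Restricting \<open>f\<close> to the line through \<open>x\<close> and \<open>y\<close>
  reduces the claim to the tangent inequality for a convex function of one real variable.\<close>

lemma convex_gradient_below:
  fixes f :: "'a::real_inner \<Rightarrow> real"
  assumes grad: "(f has_derivative (\<lambda>d. D \<bullet> d)) (at x)"
    and convex: "convex_on UNIV f"
  shows "f x + D \<bullet> (y - x) \<le> f y"
proof -
  define p where "p t = f (x + t *\<^sub>R (y - x))" for t
  have conv: "convex_on UNIV p"
  proof (rule convex_onI)
    fix t a b :: real assume t: "0 < t" "t < 1"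
    have "p ((1 - t) *\<^sub>R a + t *\<^sub>R b)
        = f ((1 - t) *\<^sub>R (x + a *\<^sub>R (y - x)) + t *\<^sub>R (x + b *\<^sub>R (y - x)))"
      unfolding p_def by (rule arg_cong[of _ _ f]) (simp add: algebra_simps)
    also have "\<dots> \<le> (1 - t) * p a + t * p b"
      unfolding p_def using convex_onD[OF convex, of t] t by auto
    finally show "p ((1 - t) *\<^sub>R a + t *\<^sub>R b) \<le> (1 - t) * p a + t * p b" .
  qed auto
  have "((\<lambda>t. f (x + t *\<^sub>R (y - x))) has_derivative (\<lambda>s. D \<bullet> (s *\<^sub>R (y - x)))) (at 0)"
    by (rule has_derivative_compose[where g = f]) (auto intro!: derivative_eq_intros grad)
  then have "(p has_real_derivative D \<bullet> (y - x)) (at 0)"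
    unfolding has_field_derivative_def p_def by (simp add: mult.commute[of _ "_ \<bullet> _"])
  then have "p 1 - p 0 \<ge> (D \<bullet> (y - x)) * (1 - 0)"
    by (intro convex_on_imp_above_tangent[OF conv]) (auto)
  then show ?thesis by (simp add: p_def)
qed

subsection \<open>Stein's identity\<close>

lemma integrable_std_normal_poly_growth:
  fixes F :: "real \<Rightarrow> real"
  assumes [measurable]: "F \<in> borel_measurable borel"
    and bound: "\<And>t. \<bar>F t\<bar> \<le> C * (1 + \<bar>t\<bar>) ^ k"
  shows "integrable lborel (\<lambda>t. std_normal_density t * F t)"
proof (rule Bochner_Integration.integrable_bound)
  \<comment> \<open>The binomial expansion of \<open>(1 + |t|) ^ k\<close> turns the dominating
    function into a finite sum of absolute Gaussian moments.\<close>
  have "integrable lborel (\<lambda>t. C * (\<Sum>j\<le>k. real (k choose j) * (std_normal_density t * \<bar>t\<bar> ^ (k - j))))"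
    by (intro integrable_mult_right Bochner_Integration.integrable_sum integrable_std_normal_moment_abs)
  also have "(\<lambda>t. C * (\<Sum>j\<le>k. real (k choose j) * (std_normal_density t * \<bar>t\<bar> ^ (k - j))))
      = (\<lambda>t. std_normal_density t * (C * (1 + \<bar>t\<bar>) ^ k))"
    by (auto simp: binomial_ring sum_distrib_left intro!: sum.cong)
  finally show "integrable lborel (\<lambda>t. std_normal_density t * (C * (1 + \<bar>t\<bar>) ^ k))" .
  show "AE t in lborel. norm (std_normal_density t * F t) \<le> norm (std_normal_density t * (C * (1 + \<bar>t\<bar>) ^ k))"
  proof (rule AE_I2)
    fix t show "norm (std_normal_density t * F t) \<le> norm (std_normal_density t * (C * (1 + \<bar>t\<bar>) ^ k))"
      using order_trans[OF bound abs_ge_self, of t] unfolding norm_mult[of "std_normal_density t"]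
      by (intro mult_left_mono) auto
  qed
qed simp

text \<open>These limits are the boundary terms of the integration by parts below. Since
  \<open>(1 + |t|) ^ k \<le> exp (k * |t|)\<close>, both reduce to
  \<open>exp (K * |t| - t^2 / 2)\<close> tending to 0.\<close>

lemma std_normal_poly_growth_tendsto_0:
  fixes F :: "real \<Rightarrow> real"
  assumes bound: "\<And>t. \<bar>F t\<bar> \<le> C * (1 + \<bar>t\<bar>) ^ k"
  shows "((\<lambda>t. std_normal_density t * F t) \<longlongrightarrow> 0) at_top"
    and "((\<lambda>t. std_normal_density t * F t) \<longlongrightarrow> 0) at_bot"
proof -
  have C: "0 \<le> C" using bound[of 0] by simp
  have le: "norm (std_normal_density t * F t) \<le> std_normal_density t * (C * exp (real k * \<bar>t\<bar>))" for t
  proof -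
    have "(1 + \<bar>t\<bar>) ^ k \<le> exp \<bar>t\<bar> ^ k" by (intro power_mono exp_ge_add_one_self) auto
    also have "\<dots> = exp (real k * \<bar>t\<bar>)" by (simp add: exp_of_nat_mult)
    finally have "C * (1 + \<bar>t\<bar>) ^ k \<le> C * exp (real k * \<bar>t\<bar>)" using C by (intro mult_left_mono)
    with bound[of t] have "\<bar>F t\<bar> \<le> C * exp (real k * \<bar>t\<bar>)" by linarith
    then show ?thesis by (auto simp: abs_mult intro!: mult_left_mono)
  qed
  have eq: "std_normal_density t * (C * exp (real k * \<bar>t\<bar>))
      = C / sqrt (2 * pi) * exp (real k * \<bar>t\<bar> - t\<^sup>2 / 2)" for t
  proof -
    have "exp (real k * \<bar>t\<bar> - t\<^sup>2 / 2) = exp (- t\<^sup>2 / 2) * exp (real k * \<bar>t\<bar>)"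
      by (simp flip: exp_add)
    then show ?thesis by (simp add: std_normal_density_def)
  qed
  have "((\<lambda>t. exp (K * \<bar>t\<bar> - t\<^sup>2 / 2)) \<longlongrightarrow> 0) at_top" for K :: real
    by real_asymp
  from tendsto_mult_right_zero[OF this]
  have lim: "((\<lambda>t. std_normal_density t * (C * exp (real k * \<bar>t\<bar>))) \<longlongrightarrow> 0) at_top"
    unfolding eq .
  show "((\<lambda>t. std_normal_density t * F t) \<longlongrightarrow> 0) at_top"
    by (rule Lim_null_comparison[OF _ lim]) (use le in auto)
  have "((\<lambda>t. exp (K * \<bar>t\<bar> - t\<^sup>2 / 2)) \<longlongrightarrow> 0) at_bot" for K :: real
    by real_asymp
  from tendsto_mult_right_zero[OF this]
  have lim: "((\<lambda>t. std_normal_density t * (C * exp (real k * \<bar>t\<bar>))) \<longlongrightarrow> 0) at_bot"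
    unfolding eq .
  show "((\<lambda>t. std_normal_density t * F t) \<longlongrightarrow> 0) at_bot"
    by (rule Lim_null_comparison[OF _ lim]) (use le in auto)
qed

lemma DERIV_std_normal_density:
  "(std_normal_density has_real_derivative - t * std_normal_density t) (at t)"
proof -
  have "((\<lambda>t. exp (- t\<^sup>2 / 2)) has_real_derivative - t * exp (- t\<^sup>2 / 2)) (at t)"
    by (auto intro!: derivative_eq_intros)
  from DERIV_cmult[OF this, of "1 / sqrt (2 * pi)"] show ?thesis
    unfolding std_normal_density_def by (simp add: mult_ac)
qed

text \<open>The density \<open>\<phi>\<close> satisfies \<open>\<phi>'(t) = - t \<phi>(t)\<close>,
  so the difference of the two integrands is the derivative of \<open>\<phi> F\<close>. Its integral
  over the line is the difference of the limits of \<open>\<phi> F\<close>, both of which are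
  0.\<close>

lemma std_normal_stein:
  fixes F F' :: "real \<Rightarrow> real"
  assumes deriv: "\<And>t. (F has_real_derivative F' t) (at t)"
    and cont: "continuous_on UNIV F'"
    and bound: "\<And>t. \<bar>F t\<bar> \<le> C * (1 + \<bar>t\<bar>) ^ k"
    and bound': "\<And>t. \<bar>F' t\<bar> \<le> C * (1 + \<bar>t\<bar>) ^ k"
  shows "(\<integral>t. std_normal_density t * F' t \<partial>lborel) = (\<integral>t. std_normal_density t * (t * F t) \<partial>lborel)"
proof -
  have contF: "continuous_on UNIV F"
    using deriv by (auto intro!: DERIV_isCont simp: continuous_on_eq_continuous_at)
  have [measurable]: "F \<in> borel_measurable borel" "F' \<in> borel_measurable borel"
    using contF cont by (auto intro: borel_measurable_continuous_onI)
  let ?p = "\<lambda>t. std_normal_density t * F' t - std_normal_density t * (t * F t)"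
  have int': "integrable lborel (\<lambda>t. std_normal_density t * F' t)"
    by (rule integrable_std_normal_poly_growth[OF _ bound']) auto
  have int: "integrable lborel (\<lambda>t. std_normal_density t * (t * F t))"
  proof (rule integrable_std_normal_poly_growth)
    fix t
    have "\<bar>t * F t\<bar> \<le> (1 + \<bar>t\<bar>) * (C * (1 + \<bar>t\<bar>) ^ k)"
      unfolding abs_mult by (intro mult_mono bound) auto
    then show "\<bar>t * F t\<bar> \<le> C * (1 + \<bar>t\<bar>) ^ Suc k" by (simp add: mult_ac)
  qed auto
  have p: "isCont std_normal_density t" for t
    by (rule DERIV_isCont[OF DERIV_std_normal_density])
  have "(LBINT t=-\<infinity>..\<infinity>. ?p t) = 0 - 0"
  proof (rule interval_integral_FTC_integrable[where F = "\<lambda>t. std_normal_density t * F t"])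
    fix t :: real
    show "((\<lambda>t. std_normal_density t * F t) has_vector_derivative ?p t) (at t)"
      unfolding has_real_derivative_iff_has_vector_derivative[symmetric]
      by (rule DERIV_cong[OF DERIV_mult[OF DERIV_std_normal_density deriv]]) simp
    show "isCont ?p t"
      using contF cont by (intro continuous_intros p) (auto simp: continuous_on_eq_continuous_at)
  next
    show "set_integrable lborel (einterval (-\<infinity>) \<infinity>) ?p"
      unfolding set_integrable_def using int int' by (simp add: einterval_def)
  qed (auto simp: ereal_tendsto_simps intro: std_normal_poly_growth_tendsto_0[OF bound])
  then have "(\<integral>t. ?p t \<partial>lborel) = 0"
    by (simp add: interval_lebesgue_integral_def set_lebesgue_integral_def einterval_def)
  then show ?thesis using int int' by simp
qed

section \<open>Iterated integrals over independent random variables\<close>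

lemma (in prob_space) indep_var_nn_integral_iterated:
  assumes indep: "indep_var S X T Y"
    and [measurable]: "\<Phi> \<in> borel_measurable (S \<Otimes>\<^sub>M T)"
  shows "(\<integral>\<^sup>+\<omega>. \<Phi> (X \<omega>, Y \<omega>) \<partial>M) = (\<integral>\<^sup>+\<omega>. (\<integral>\<^sup>+\<omega>'. \<Phi> (X \<omega>, Y \<omega>') \<partial>M) \<partial>M)"
proof -
  have [measurable]: "X \<in> M \<rightarrow>\<^sub>M S" "Y \<in> M \<rightarrow>\<^sub>M T"
    and prod: "distr M S X \<Otimes>\<^sub>M distr M T Y = distr M (S \<Otimes>\<^sub>M T) (\<lambda>\<omega>. (X \<omega>, Y \<omega>))"
    using indep by (auto simp: indep_var_distribution_eq)
  interpret T: prob_space "distr M T Y" by (rule prob_space_distr) simp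
  have "(\<integral>\<^sup>+\<omega>. \<Phi> (X \<omega>, Y \<omega>) \<partial>M) = (\<integral>\<^sup>+z. \<Phi> z \<partial>(distr M S X \<Otimes>\<^sub>M distr M T Y))"
    unfolding prod by (subst nn_integral_distr) auto
  also have "\<dots> = (\<integral>\<^sup>+x. (\<integral>\<^sup>+y. \<Phi> (x, y) \<partial>distr M T Y) \<partial>distr M S X)"
    by (subst T.nn_integral_fst[symmetric]) auto
  also have "\<dots> = (\<integral>\<^sup>+\<omega>. (\<integral>\<^sup>+y. \<Phi> (X \<omega>, y) \<partial>distr M T Y) \<partial>M)"
    by (subst nn_integral_distr) auto
  also have "\<dots> = (\<integral>\<^sup>+\<omega>. (\<integral>\<^sup>+\<omega>'. \<Phi> (X \<omega>, Y \<omega>') \<partial>M) \<partial>M)"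
  proof (rule nn_integral_cong)
    fix \<omega> assume "\<omega> \<in> space M"
    then have "X \<omega> \<in> space S" by (rule measurable_space[rotated]) simp
    then show "(\<integral>\<^sup>+y. \<Phi> (X \<omega>, y) \<partial>distr M T Y) = (\<integral>\<^sup>+\<omega>'. \<Phi> (X \<omega>, Y \<omega>') \<partial>M)"
      by (subst nn_integral_distr) auto
  qed
  finally show ?thesis .
qed

text \<open>Fubini on the product of the two distributions, here with \<open>X\<close> integrated
  first: in Stein's identity one coordinate is averaged while the others stay fixed.\<close>

lemma (in prob_space) indep_var_integral_iterated:
  fixes \<Phi> :: "_ \<Rightarrow> real"
  assumes indep: "indep_var S X T Y"
    and [measurable]: "\<Phi> \<in> borel_measurable (S \<Otimes>\<^sub>M T)"
    and int: "integrable M (\<lambda>\<omega>. \<Phi> (X \<omega>, Y \<omega>))"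
  shows "(\<integral>\<omega>. \<Phi> (X \<omega>, Y \<omega>) \<partial>M) = (\<integral>\<omega>'. (\<integral>\<omega>. \<Phi> (X \<omega>, Y \<omega>') \<partial>M) \<partial>M)"
proof -
  have [measurable]: "X \<in> M \<rightarrow>\<^sub>M S" "Y \<in> M \<rightarrow>\<^sub>M T"
    and prod: "distr M S X \<Otimes>\<^sub>M distr M T Y = distr M (S \<Otimes>\<^sub>M T) (\<lambda>\<omega>. (X \<omega>, Y \<omega>))"
    using indep by (auto simp: indep_var_distribution_eq)
  interpret S: prob_space "distr M S X" by (rule prob_space_distr) simp
  interpret T: prob_space "distr M T Y" by (rule prob_space_distr) simp
  interpret pair_prob_space "distr M S X" "distr M T Y" ..
  have int': "integrable (distr M S X \<Otimes>\<^sub>M distr M T Y) (\<lambda>(x, y). \<Phi> (x, y))"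
    unfolding prod using int by (subst integrable_distr_eq) (auto simp: case_prod_beta')
  have "(\<integral>\<omega>. \<Phi> (X \<omega>, Y \<omega>) \<partial>M) = (\<integral>z. \<Phi> z \<partial>(distr M S X \<Otimes>\<^sub>M distr M T Y))"
    unfolding prod by (subst integral_distr) auto
  also have "\<dots> = (\<integral>y. (\<integral>x. \<Phi> (x, y) \<partial>distr M S X) \<partial>distr M T Y)"
    using integral_snd[OF int'] by (simp add: case_prod_beta')
  also have "\<dots> = (\<integral>\<omega>'. (\<integral>x. \<Phi> (x, Y \<omega>') \<partial>distr M S X) \<partial>M)"
    by (subst integral_distr) auto
  also have "\<dots> = (\<integral>\<omega>'. (\<integral>\<omega>. \<Phi> (X \<omega>, Y \<omega>') \<partial>M) \<partial>M)"
  proof (rule Bochner_Integration.integral_cong[OF refl])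
    fix \<omega>' assume "\<omega>' \<in> space M"
    then have "Y \<omega>' \<in> space T" by (rule measurable_space[rotated]) simp
    then show "(\<integral>x. \<Phi> (x, Y \<omega>') \<partial>distr M S X) = (\<integral>\<omega>. \<Phi> (X \<omega>, Y \<omega>') \<partial>M)"
      by (subst integral_distr) auto
  qed
  finally show ?thesis .
qed

section \<open>Standard Gaussian vectors and Stein's identity in several variables\<close>

lemma borel_measurable_vec_lambda:
  fixes f :: "'n::finite \<Rightarrow> 'a \<Rightarrow> real"
  assumes "\<And>i. f i \<in> borel_measurable M"
  shows "(\<lambda>x. \<chi> i. f i x) \<in> borel_measurable M"
  unfolding borel_measurable_euclidean_space[where 'c = "real^'n"]
  using assms by (auto simp: Basis_vec_def inner_axis)

lemma borel_measurable_vec_nth [measurable (raw)]: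
  fixes f :: "'a \<Rightarrow> real^'n"
  assumes "f \<in> borel_measurable M"
  shows "(\<lambda>x. f x $ i) \<in> borel_measurable M"
  using measurable_compose[OF assms, of "\<lambda>x. x $ i" borel]
  by (simp add: borel_measurable_continuous_onI continuous_intros)

text \<open>Mean 0 and covariance the identity are encoded through independent standard normal
  coordinates, the form in which the one-dimensional identity can be applied coordinate by
  coordinate.\<close>

locale gaussian_vector = prob_space M for M :: "'w measure" +
  fixes U :: "'w \<Rightarrow> real^'n"
  assumes indep_coord: "indep_vars (\<lambda>_. borel) (\<lambda>i \<omega>. U \<omega> $ i) UNIV"
    and distributed_coord: "\<And>i. distributed M lborel (\<lambda>\<omega>. U \<omega> $ i) std_normal_density"
begin

lemma measurable_coord [measurable]: "(\<lambda>\<omega>. U \<omega> $ i) \<in> borel_measurable M"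
  using distributed_measurable[OF distributed_coord[of i]] by simp

lemma measurable_U [measurable]: "U \<in> borel_measurable M"
  using borel_measurable_vec_lambda[of "\<lambda>i \<omega>. U \<omega> $ i" M] by simp

lemma integrable_coord_power: "integrable M (\<lambda>\<omega>. \<bar>U \<omega> $ i\<bar> ^ k)"
  using distributed_integrable[OF distributed_coord[of i], of "\<lambda>t. \<bar>t\<bar> ^ k"]
    integrable_std_normal_moment_abs[of k] by simp

text \<open>The norm is at most the dimension times the largest coordinate, so a power of it is
  controlled by the sum of the same powers of all coordinates, each of which has a finite
  moment.\<close>

lemma integrable_poly_growth:
  fixes F :: "real^'n \<Rightarrow> real"
  assumes [measurable]: "F \<in> borel_measurable borel"
    and bound: "\<And>x. \<bar>F x\<bar> \<le> C * (1 + norm x) ^ k"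
  shows "integrable M (\<lambda>\<omega>. F (U \<omega>))"
proof (rule Bochner_Integration.integrable_bound)
  let ?B = "\<lambda>x::real^'n. C * (real (CARD('n) + 1) ^ k * (1 + (\<Sum>i\<in>UNIV. \<bar>x $ i\<bar> ^ k)))"
  show "integrable M (\<lambda>\<omega>. ?B (U \<omega>))"
    by (intro integrable_mult_right Bochner_Integration.integrable_add
        Bochner_Integration.integrable_sum integrable_coord_power) simp
  have C: "0 \<le> C" using bound[of 0] by simp
  have "\<bar>F x\<bar> \<le> ?B x" for x
  proof -
    have "Max (range (\<lambda>i. \<bar>x $ i\<bar>)) \<in> range (\<lambda>i. \<bar>x $ i\<bar>)" by (rule Max_in) auto
    then obtain j where "\<bar>x $ j\<bar> = Max (range (\<lambda>i. \<bar>x $ i\<bar>))" by (metis imageE)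
    then have j: "\<bar>x $ i\<bar> \<le> \<bar>x $ j\<bar>" for i by simp
    \<comment> \<open>The maximum with 1 absorbs the summand 1 in \<open>1 + norm x\<close>;
      afterwards \<open>m ^ k\<close> is either 1 or \<open>|x $ j| ^ k\<close>.\<close>
    define m where "m = max 1 \<bar>x $ j\<bar>"
    have "norm x \<le> (\<Sum>i\<in>UNIV. \<bar>x $ i\<bar>)" by (rule norm_le_l1_cart)
    also have "\<dots> \<le> real CARD('n) * m"
      using j by (intro sum_bounded_above[THEN order_trans]) (auto simp: m_def intro: max.coboundedI2)
    finally have "1 + norm x \<le> real (CARD('n) + 1) * m" by (simp add: m_def algebra_simps)
    then have "(1 + norm x) ^ k \<le> (real (CARD('n) + 1) * m) ^ k" by (intro power_mono) auto
    also have "\<dots> = real (CARD('n) + 1) ^ k * m ^ k" by (rule power_mult_distrib)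
    also have "m ^ k \<le> 1 + (\<Sum>i\<in>UNIV. \<bar>x $ i\<bar> ^ k)"
    proof -
      have "\<bar>x $ j\<bar> ^ k \<le> (\<Sum>i\<in>UNIV. \<bar>x $ i\<bar> ^ k)" by (rule member_le_sum) auto
      moreover have "0 \<le> (\<Sum>i\<in>UNIV. \<bar>x $ i\<bar> ^ k)" by (intro sum_nonneg) auto
      ultimately show ?thesis by (auto simp: m_def max_def)
    qed
    finally have "C * (1 + norm x) ^ k \<le> ?B x" using C by (intro mult_left_mono) auto
    with bound[of x] show ?thesis by linarith
  qed
  then show "AE \<omega> in M. norm (F (U \<omega>)) \<le> norm (?B (U \<omega>))"
    by (intro AE_I2) (simp only: real_norm_def order_trans[OF _ abs_ge_self])
qed simp

text \<open>The coordinate is carried as a multiple of an axis vector so that both parts have the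
  same value type, as \<open>indep_var\<close> demands, and add up to \<open>U\<close>.\<close>

lemma indep_coord_rest:
  "indep_var borel (\<lambda>\<omega>. (U \<omega> $ i) *\<^sub>R axis i 1) borel (\<lambda>\<omega>. U \<omega> - (U \<omega> $ i) *\<^sub>R axis i 1)"
proof -
  have "indep_var (Pi\<^sub>M {i} (\<lambda>_. borel)) (\<lambda>\<omega>. restrict (\<lambda>j. U \<omega> $ j) {i})
      (Pi\<^sub>M (- {i}) (\<lambda>_. borel)) (\<lambda>\<omega>. restrict (\<lambda>j. U \<omega> $ j) (- {i}))"
    by (rule indep_var_restrict[OF indep_coord]) auto
  then have "indep_var borel ((\<lambda>p. p i *\<^sub>R axis i 1 :: real^'n) \<circ> (\<lambda>\<omega>. restrict (\<lambda>j. U \<omega> $ j) {i}))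
      borel ((\<lambda>p. \<chi> j. if j = i then 0 else p j) \<circ> (\<lambda>\<omega>. restrict (\<lambda>j. U \<omega> $ j) (- {i})))"
  proof (rule indep_var_compose)
    show "(\<lambda>p. \<chi> j. if j = i then 0 else p j) \<in> Pi\<^sub>M (- {i}) (\<lambda>_. borel) \<rightarrow>\<^sub>M (borel :: (real^'n) measure)"
    proof (rule borel_measurable_vec_lambda)
      show "(\<lambda>p. if j = i then 0 else p j) \<in> borel_measurable (Pi\<^sub>M (- {i}) (\<lambda>_. borel))" for j
        by (cases "j = i") auto
    qed
  qed simp
  moreover have "(\<lambda>p. \<chi> j. if j = i then 0 else p j) \<circ> (\<lambda>\<omega>. restrict (\<lambda>j. U \<omega> $ j) (- {i}))
      = (\<lambda>\<omega>. U \<omega> - (U \<omega> $ i) *\<^sub>R axis i 1)"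
    by (auto simp: fun_eq_iff vec_eq_iff axis_def)
  ultimately show ?thesis by (simp add: comp_def)
qed

text \<open>With the other coordinates frozen at \<open>y\<close>, this is the one-dimensional
  identity for \<open>t \<mapsto> F (y + t e_i)\<close>. Independence of the coordinate from the
  rest then allows averaging over \<open>y\<close>.\<close>

lemma stein_coord:
  fixes F :: "real^'n \<Rightarrow> real"
  assumes deriv: "\<And>x. (F has_derivative (\<lambda>d. G x \<bullet> d)) (at x)"
    and cont: "continuous_on UNIV G"
    and bound: "\<And>x. \<bar>F x\<bar> \<le> C * (1 + norm x) ^ k"
    and bound': "\<And>x. norm (G x) \<le> C * (1 + norm x) ^ k"
  shows "expectation (\<lambda>\<omega>. G (U \<omega>) $ i) = expectation (\<lambda>\<omega>. U \<omega> $ i * F (U \<omega>))"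
proof -
  let ?e = "axis i 1 :: real^'n"
  define X where "X \<omega> = U \<omega> $ i" for \<omega>
  define Y where "Y \<omega> = U \<omega> - (U \<omega> $ i) *\<^sub>R axis i 1" for \<omega>
  have C: "0 \<le> C" using bound[of 0] by simp
  have indep: "indep_var borel (\<lambda>\<omega>. X \<omega> *\<^sub>R ?e) borel Y" using indep_coord_rest[of i] by (simp add: X_def[abs_def] Y_def[abs_def])
  have [measurable]: "X \<in> borel_measurable M" using measurable_coord[of i] by (simp add: X_def[abs_def])
  have contF: "continuous_on UNIV F"
    using deriv by (auto intro!: has_derivative_continuous simp: continuous_on_eq_continuous_at)
  have [measurable]: "F \<in> borel_measurable borel" "G \<in> borel_measurable borel"
    using contF cont by (auto intro: borel_measurable_continuous_onI)
  have boundG: "\<bar>G x $ i\<bar> \<le> C * (1 + norm x) ^ k" for x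
    using component_le_norm_cart[of "G x" i] bound'[of x] by linarith
  have U: "U \<omega> = Y \<omega> + X \<omega> *\<^sub>R ?e" for \<omega> by (simp add: X_def Y_def)
  have Y0: "Y \<omega> $ i = 0" for \<omega> by (simp add: Y_def)
  have inner: "expectation (\<lambda>\<omega>. G (y + X \<omega> *\<^sub>R ?e) $ i) = expectation (\<lambda>\<omega>. X \<omega> * F (y + X \<omega> *\<^sub>R ?e))" for y
  proof -
    have b: "C * (1 + norm (y + t *\<^sub>R ?e)) ^ k \<le> (C * (1 + norm y) ^ k) * (1 + \<bar>t\<bar>) ^ k" for t
    proof -
      have "norm (y + t *\<^sub>R ?e) \<le> norm y + \<bar>t\<bar>" by (rule order_trans[OF norm_triangle_ineq]) simp
      then have "1 + norm (y + t *\<^sub>R ?e) \<le> (1 + norm y) * (1 + \<bar>t\<bar>)"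
        using mult_nonneg_nonneg[OF norm_ge_zero[of y] abs_ge_zero[of t]]
        unfolding ring_distribs by linarith
      then have "(1 + norm (y + t *\<^sub>R ?e)) ^ k \<le> ((1 + norm y) * (1 + \<bar>t\<bar>)) ^ k"
        by (intro power_mono) auto
      then show ?thesis using C by (simp add: power_mult_distrib mult.assoc mult_left_mono)
    qed
    have "expectation (\<lambda>\<omega>. G (y + X \<omega> *\<^sub>R ?e) $ i) = (\<integral>t. std_normal_density t * (G (y + t *\<^sub>R ?e) $ i) \<partial>lborel)"
      unfolding X_def by (rule distributed_integral[OF distributed_coord, symmetric]) auto
    also have "\<dots> = (\<integral>t. std_normal_density t * (t * F (y + t *\<^sub>R ?e)) \<partial>lborel)"
    proof (rule std_normal_stein)
      fix t
      have "((\<lambda>t. F (y + t *\<^sub>R ?e)) has_derivative (\<lambda>s. G (y + t *\<^sub>R ?e) \<bullet> (s *\<^sub>R ?e))) (at t)"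
        by (rule has_derivative_compose[OF _ deriv]) (auto intro!: derivative_eq_intros)
      then show "((\<lambda>t. F (y + t *\<^sub>R ?e)) has_real_derivative G (y + t *\<^sub>R ?e) $ i) (at t)"
        unfolding has_field_derivative_def
        by (simp add: inner_axis mult.commute[of _ "_ $ _"])
      show "\<bar>F (y + t *\<^sub>R ?e)\<bar> \<le> (C * (1 + norm y) ^ k) * (1 + \<bar>t\<bar>) ^ k"
        using bound b by (rule order_trans)
      show "\<bar>G (y + t *\<^sub>R ?e) $ i\<bar> \<le> (C * (1 + norm y) ^ k) * (1 + \<bar>t\<bar>) ^ k"
        using boundG b by (rule order_trans)
    next
      show "continuous_on UNIV (\<lambda>t. G (y + t *\<^sub>R ?e) $ i)"
        by (intro continuous_intros continuous_on_compose2[OF cont]) auto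
    qed
    also have "\<dots> = expectation (\<lambda>\<omega>. X \<omega> * F (y + X \<omega> *\<^sub>R ?e))"
      unfolding X_def by (rule distributed_integral[OF distributed_coord]) auto
    finally show ?thesis .
  qed
  have "integrable M (\<lambda>\<omega>. G (U \<omega>) $ i)"
    by (rule integrable_poly_growth[OF _ boundG]) simp
  then have 1: "expectation (\<lambda>\<omega>. G (U \<omega>) $ i) = expectation (\<lambda>\<omega>'. expectation (\<lambda>\<omega>. G (Y \<omega>' + X \<omega> *\<^sub>R ?e) $ i))"
    unfolding U
    using indep_var_integral_iterated[OF indep, of "\<lambda>(x, y). G (y + x) $ i"] by simp
  have "integrable M (\<lambda>\<omega>. U \<omega> $ i * F (U \<omega>))"
  proof (rule integrable_poly_growth)
    fix x
    have "\<bar>x $ i * F x\<bar> \<le> (1 + norm x) * (C * (1 + norm x) ^ k)"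
      unfolding abs_mult using component_le_norm_cart[of x i] by (intro mult_mono bound) auto
    then show "\<bar>x $ i * F x\<bar> \<le> C * (1 + norm x) ^ Suc k" by (simp add: mult_ac)
  qed simp
  then have 2: "expectation (\<lambda>\<omega>. U \<omega> $ i * F (U \<omega>)) = expectation (\<lambda>\<omega>'. expectation (\<lambda>\<omega>. X \<omega> * F (Y \<omega>' + X \<omega> *\<^sub>R ?e)))"
    unfolding U
    using indep_var_integral_iterated[OF indep, of "\<lambda>(x, y). x $ i * F (y + x)"] by (simp add: Y0)
  show ?thesis unfolding 1 2 inner ..
qed

lemma stein:
  fixes F :: "real^'n \<Rightarrow> real"
  assumes deriv: "\<And>x. (F has_derivative (\<lambda>d. G x \<bullet> d)) (at x)"
    and cont: "continuous_on UNIV G"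
    and bound: "\<And>x. \<bar>F x\<bar> \<le> C * (1 + norm x) ^ k"
    and bound': "\<And>x. norm (G x) \<le> C * (1 + norm x) ^ k"
  shows "expectation (\<lambda>\<omega>. G (U \<omega>) \<bullet> w) = expectation (\<lambda>\<omega>. F (U \<omega>) * (U \<omega> \<bullet> w))"
proof -
  have contF: "continuous_on UNIV F"
    using deriv by (auto intro!: has_derivative_continuous simp: continuous_on_eq_continuous_at)
  have [measurable]: "F \<in> borel_measurable borel" "G \<in> borel_measurable borel"
    using contF cont by (auto intro: borel_measurable_continuous_onI)
  have 1: "integrable M (\<lambda>\<omega>. G (U \<omega>) $ i)" for i
  proof (rule integrable_poly_growth)
    show "\<bar>G x $ i\<bar> \<le> C * (1 + norm x) ^ k" for x
      using component_le_norm_cart[of "G x" i] bound'[of x] by linarith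
  qed simp
  have 2: "integrable M (\<lambda>\<omega>. U \<omega> $ i * F (U \<omega>))" for i
  proof (rule integrable_poly_growth)
    fix x
    have "\<bar>x $ i * F x\<bar> \<le> (1 + norm x) * (C * (1 + norm x) ^ k)"
      unfolding abs_mult using component_le_norm_cart[of x i] by (intro mult_mono bound) auto
    then show "\<bar>x $ i * F x\<bar> \<le> C * (1 + norm x) ^ Suc k" by (simp add: mult_ac)
  qed simp
  have "expectation (\<lambda>\<omega>. G (U \<omega>) \<bullet> w) = (\<Sum>i\<in>UNIV. expectation (\<lambda>\<omega>. G (U \<omega>) $ i) * w $ i)"
    unfolding inner_vec_def using 1 by (subst Bochner_Integration.integral_sum) auto
  also have "\<dots> = (\<Sum>i\<in>UNIV. expectation (\<lambda>\<omega>. U \<omega> $ i * F (U \<omega>)) * w $ i)"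
    using stein_coord[OF assms] by simp
  also have "\<dots> = expectation (\<lambda>\<omega>. (\<Sum>i\<in>UNIV. (U \<omega> $ i * F (U \<omega>)) * w $ i))"
    using 2 by (subst Bochner_Integration.integral_sum) auto
  also have "\<dots> = expectation (\<lambda>\<omega>. F (U \<omega>) * (U \<omega> \<bullet> w))"
    unfolding inner_vec_def by (simp add: sum_distrib_left mult_ac)
  finally show ?thesis .
qed

text \<open>Stein's identity applied to \<open>x_i q(x)\<close> and summed over \<open>i\<close>
  replaces \<open>|x|^2 q(x)\<close> by the divergence of the field \<open>x q(x)\<close>, which is
  \<open>n q + G x \<bullet> x\<close>. Euler's relation makes this \<open>(n + d) q\<close>. The
  result is a recursion that raises the degree of a moment by two.\<close>

lemma expectation_norm_square_homogeneous:
  fixes q :: "real^'n \<Rightarrow> real"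
  assumes deriv: "\<And>x. (q has_derivative (\<lambda>d. G x \<bullet> d)) (at x)"
    and cont: "continuous_on UNIV G"
    and bound: "\<And>x. \<bar>q x\<bar> \<le> C * (1 + norm x) ^ k"
    and bound': "\<And>x. norm (G x) \<le> C * (1 + norm x) ^ k"
    and euler: "\<And>x. G x \<bullet> x = d * q x"
  shows "expectation (\<lambda>\<omega>. (norm (U \<omega>))\<^sup>2 * q (U \<omega>)) = (real CARD('n) + d) * expectation (\<lambda>\<omega>. q (U \<omega>))"
proof -
  have C: "0 \<le> C" using bound[of 0] by simp
  have contq: "continuous_on UNIV q"
    using deriv by (auto intro!: has_derivative_continuous simp: continuous_on_eq_continuous_at)
  have [measurable]: "q \<in> borel_measurable borel" "G \<in> borel_measurable borel"
    using contq cont by (auto intro: borel_measurable_continuous_onI)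
  \<comment> \<open>\<open>H i\<close> is the gradient of
    \<open>x \<mapsto> x $ i * q x\<close>.\<close>
  define H where "H i x = q x *\<^sub>R axis i 1 + (x $ i) *\<^sub>R G x" for i :: 'n and x
  have b1: "\<bar>x $ i * q x\<bar> \<le> 2 * C * (1 + norm x) ^ Suc k" for x i
  proof -
    have "\<bar>x $ i * q x\<bar> \<le> (1 + norm x) * (C * (1 + norm x) ^ k)"
      unfolding abs_mult using component_le_norm_cart[of x i] by (intro mult_mono bound) auto
    also have "\<dots> \<le> 2 * ((1 + norm x) * (C * (1 + norm x) ^ k))" using C by simp
    finally show ?thesis by (simp add: mult_ac)
  qed
  have b2: "norm (H i x) \<le> 2 * C * (1 + norm x) ^ Suc k" for x i
  proof -
    have "norm (H i x) \<le> \<bar>q x\<bar> + \<bar>x $ i\<bar> * norm (G x)"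
      unfolding H_def by (rule order_trans[OF norm_triangle_ineq]) simp
    also have "\<dots> \<le> C * (1 + norm x) ^ k + norm x * (C * (1 + norm x) ^ k)"
      using component_le_norm_cart[of x i] by (intro add_mono mult_mono bound bound') auto
    also have "\<dots> = C * (1 + norm x) ^ Suc k" by (simp add: algebra_simps)
    also have "\<dots> \<le> 2 * (C * (1 + norm x) ^ Suc k)" using C by simp
    finally show ?thesis by (simp add: mult_ac)
  qed
  have stein: "expectation (\<lambda>\<omega>. H i (U \<omega>) $ i) = expectation (\<lambda>\<omega>. U \<omega> $ i * (U \<omega> $ i * q (U \<omega>)))" for i
  proof (rule stein_coord[OF _ _ b1 b2])
    show "((\<lambda>x. x $ i * q x) has_derivative (\<lambda>d. H i x \<bullet> d)) (at x)" for x
      by (rule derivative_eq_intros deriv bounded_linear_imp_has_derivative bounded_linear_vec_nth)+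
        (auto simp: H_def fun_eq_iff inner_axis' inner_add_left)
    show "continuous_on UNIV (H i)"
      unfolding H_def by (intro continuous_intros contq cont)
  qed
  have 1: "integrable M (\<lambda>\<omega>. H i (U \<omega>) $ i)" for i
  proof (rule integrable_poly_growth)
    show "\<bar>H i x $ i\<bar> \<le> 2 * C * (1 + norm x) ^ Suc k" for x
      using component_le_norm_cart[of "H i x" i] b2[of i x] by linarith
  qed (simp add: H_def)
  have 2: "integrable M (\<lambda>\<omega>. U \<omega> $ i * (U \<omega> $ i * q (U \<omega>)))" for i
  proof (rule integrable_poly_growth)
    fix x
    have "\<bar>x $ i * (x $ i * q x)\<bar> \<le> (1 + norm x) * (2 * C * (1 + norm x) ^ Suc k)"
      unfolding abs_mult[of "x $ i" "x $ i * q x"]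
      using component_le_norm_cart[of x i] by (intro mult_mono b1) auto
    then show "\<bar>x $ i * (x $ i * q x)\<bar> \<le> 2 * C * (1 + norm x) ^ Suc (Suc k)" by (simp add: mult_ac)
  qed simp
  have "(norm x)\<^sup>2 * q x = (\<Sum>i\<in>UNIV. x $ i * (x $ i * q x))" for x :: "real^'n"
    unfolding power2_norm_eq_inner inner_vec_def by (simp add: sum_distrib_right mult.assoc)
  then have "expectation (\<lambda>\<omega>. (norm (U \<omega>))\<^sup>2 * q (U \<omega>)) = (\<Sum>i\<in>UNIV. expectation (\<lambda>\<omega>. H i (U \<omega>) $ i))"
    using 2 by (simp add: stein)
  also have "\<dots> = expectation (\<lambda>\<omega>. (\<Sum>i\<in>UNIV. H i (U \<omega>) $ i))"
    using 1 by simp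
  also have "(\<lambda>\<omega>. \<Sum>i\<in>UNIV. H i (U \<omega>) $ i) = (\<lambda>\<omega>. (real CARD('n) + d) * q (U \<omega>))"
  proof
    fix \<omega>
    have "(\<Sum>i\<in>UNIV. H i (U \<omega>) $ i) = real CARD('n) * q (U \<omega>) + G (U \<omega>) \<bullet> U \<omega>"
      unfolding H_def inner_vec_def by (simp add: sum.distrib mult.commute)
    then show "(\<Sum>i\<in>UNIV. H i (U \<omega>) $ i) = (real CARD('n) + d) * q (U \<omega>)"
      by (simp add: euler algebra_simps)
  qed
  finally show ?thesis by simp
qed

section \<open>Gaussian moments up to degree six\<close>

lemma expectation_inner: "expectation (\<lambda>\<omega>. U \<omega> \<bullet> c) = 0"
  using stein[of "\<lambda>_. 1" "\<lambda>_. 0" 1 0 c] by simp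

lemma expectation_inner_square: "expectation (\<lambda>\<omega>. (U \<omega> \<bullet> c)\<^sup>2) = (norm c)\<^sup>2"
proof -
  have "expectation (\<lambda>\<omega>. c \<bullet> c) = expectation (\<lambda>\<omega>. (U \<omega> \<bullet> c) * (U \<omega> \<bullet> c))"
  proof (rule stein[where C = "norm c" and k = 1])
    show "((\<lambda>x. x \<bullet> c) has_derivative (\<lambda>d. c \<bullet> d)) (at x)" for x
      by (auto intro!: derivative_eq_intros simp: inner_commute)
    fix x
    have "\<bar>x \<bullet> c\<bar> \<le> norm x * norm c" by (rule Cauchy_Schwarz_ineq2)
    also have "\<dots> \<le> norm c * (1 + norm x) ^ 1" by (simp add: algebra_simps)
    finally show "\<bar>x \<bullet> c\<bar> \<le> norm c * (1 + norm x) ^ 1" .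
    show "norm c \<le> norm c * (1 + norm x) ^ 1" by (simp add: algebra_simps)
  qed simp
  then show ?thesis by (simp add: power2_eq_square[symmetric] power2_norm_eq_inner prob_space)
qed

text \<open>The recursion starts from \<open>q = 1\<close> of degree 0. Feeding back
  \<open>|x|^2\<close> and \<open>|x|^4\<close>, of degrees 2 and 4, gives the next two moments with
  the further factors \<open>n + 2\<close> and \<open>n + 4\<close>.\<close>

lemma expectation_norm_square: "expectation (\<lambda>\<omega>. (norm (U \<omega>))\<^sup>2) = real CARD('n)"
  using expectation_norm_square_homogeneous[of "\<lambda>_. 1" "\<lambda>_. 0" 1 0 0] by (simp add: prob_space)

lemma expectation_norm_pow4: "expectation (\<lambda>\<omega>. (norm (U \<omega>)) ^ 4) = real CARD('n) * (real CARD('n) + 2)"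
proof -
  have "expectation (\<lambda>\<omega>. (norm (U \<omega>))\<^sup>2 * (U \<omega> \<bullet> U \<omega>)) = (real CARD('n) + 2) * expectation (\<lambda>\<omega>. U \<omega> \<bullet> U \<omega>)"
  proof (rule expectation_norm_square_homogeneous[where G = "\<lambda>x. 2 *\<^sub>R x" and C = 2 and k = 2])
    show "((\<lambda>x. x \<bullet> x) has_derivative (\<lambda>d. (2 *\<^sub>R x) \<bullet> d)) (at x)" for x :: "real^'n"
      by (auto intro!: derivative_eq_intros simp: inner_commute)
    show "continuous_on UNIV (\<lambda>x::real^'n. 2 *\<^sub>R x)" by (intro continuous_intros)
    fix x :: "real^'n"
    show "\<bar>x \<bullet> x\<bar> \<le> 2 * (1 + norm x)\<^sup>2" "norm (2 *\<^sub>R x) \<le> 2 * (1 + norm x)\<^sup>2" "(2 *\<^sub>R x) \<bullet> x = 2 * (x \<bullet> x)"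
      by (auto simp: power2_norm_eq_inner[symmetric] power2_sum add_nonneg_nonneg)
  qed
  moreover have "(norm x)\<^sup>2 * (x \<bullet> x) = norm x ^ 4" for x :: "real^'n"
    by (simp add: power2_norm_eq_inner[symmetric] flip: power_add)
  ultimately show ?thesis by (simp add: expectation_norm_square power2_norm_eq_inner[symmetric])
qed

lemma expectation_norm_pow6:
  "expectation (\<lambda>\<omega>. (norm (U \<omega>)) ^ 6) = real CARD('n) * (real CARD('n) + 2) * (real CARD('n) + 4)"
proof -
  have "expectation (\<lambda>\<omega>. (norm (U \<omega>))\<^sup>2 * (U \<omega> \<bullet> U \<omega>)\<^sup>2) = (real CARD('n) + 4) * expectation (\<lambda>\<omega>. (U \<omega> \<bullet> U \<omega>)\<^sup>2)"
  proof (rule expectation_norm_square_homogeneous[where G = "\<lambda>x. (4 * (x \<bullet> x)) *\<^sub>R x" and C = 4 and k = 4])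
    show "((\<lambda>x. (x \<bullet> x)\<^sup>2) has_derivative (\<lambda>d. ((4 * (x \<bullet> x)) *\<^sub>R x) \<bullet> d)) (at x)" for x :: "real^'n"
      by (auto intro!: derivative_eq_intros simp: inner_commute)
    show "continuous_on UNIV (\<lambda>x::real^'n. (4 * (x \<bullet> x)) *\<^sub>R x)" by (intro continuous_intros)
    fix x :: "real^'n"
    \<comment> \<open>One constant and one exponent must bound both the quartic \<open>q\<close> and
      its cubic gradient, so the cubic bound is raised to degree four.\<close>
    have pow: "norm x ^ 4 \<le> (1 + norm x) ^ 4" "norm x ^ 3 \<le> (1 + norm x) ^ 3"
      "(1 + norm x) ^ 3 \<le> (1 + norm x) ^ 4"
      by (auto intro: power_mono power_increasing)
    have "\<bar>(x \<bullet> x)\<^sup>2\<bar> = norm x ^ 4"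
      by (simp add: power2_norm_eq_inner[symmetric] flip: power_mult)
    with pow zero_le_power[OF norm_ge_zero, of x 4] show "\<bar>(x \<bullet> x)\<^sup>2\<bar> \<le> 4 * (1 + norm x) ^ 4" by linarith
    have "norm ((4 * (x \<bullet> x)) *\<^sub>R x) = 4 * norm x ^ 3"
      by (simp add: power2_norm_eq_inner[symmetric] power3_eq_cube power2_eq_square)
    with pow show "norm ((4 * (x \<bullet> x)) *\<^sub>R x) \<le> 4 * (1 + norm x) ^ 4" by linarith
    show "((4 * (x \<bullet> x)) *\<^sub>R x) \<bullet> x = 4 * (x \<bullet> x)\<^sup>2" by (simp add: power2_eq_square)
  qed
  moreover have "(norm x)\<^sup>2 * (x \<bullet> x)\<^sup>2 = norm x ^ 6" "(x \<bullet> x)\<^sup>2 = norm x ^ 4" for x :: "real^'n"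
    by (simp_all add: power2_norm_eq_inner[symmetric] flip: power_add power_mult)
  ultimately show ?thesis by (simp add: expectation_norm_pow4)
qed

text \<open>The recursion with the quadratic form \<open>(x \<bullet> c)^2\<close>. Its factor
  \<open>n + 2\<close> is the one that \<open>h\<close> has to beat when the gradient term is
  absorbed.\<close>

lemma expectation_norm_square_inner_square:
  "expectation (\<lambda>\<omega>. (norm (U \<omega>))\<^sup>2 * (U \<omega> \<bullet> c)\<^sup>2) = (real CARD('n) + 2) * (norm c)\<^sup>2"
proof -
  have "expectation (\<lambda>\<omega>. (norm (U \<omega>))\<^sup>2 * (U \<omega> \<bullet> c)\<^sup>2) = (real CARD('n) + 2) * expectation (\<lambda>\<omega>. (U \<omega> \<bullet> c)\<^sup>2)"
  proof (rule expectation_norm_square_homogeneous[where G = "\<lambda>x. (2 * (x \<bullet> c)) *\<^sub>R c" and C = "2 * (norm c)\<^sup>2" and k = 2])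
    show "((\<lambda>x. (x \<bullet> c)\<^sup>2) has_derivative (\<lambda>d. ((2 * (x \<bullet> c)) *\<^sub>R c) \<bullet> d)) (at x)" for x :: "real^'n"
      by (auto intro!: derivative_eq_intros simp: inner_commute)
    show "continuous_on UNIV (\<lambda>x::real^'n. (2 * (x \<bullet> c)) *\<^sub>R c)" by (intro continuous_intros)
    fix x :: "real^'n"
    have cs: "\<bar>x \<bullet> c\<bar> \<le> norm x * norm c" by (rule Cauchy_Schwarz_ineq2)
    then have "\<bar>x \<bullet> c\<bar>\<^sup>2 \<le> (norm x * norm c)\<^sup>2" by (intro power_mono) auto
    then have "(x \<bullet> c)\<^sup>2 \<le> (norm c)\<^sup>2 * (norm x)\<^sup>2" by (simp add: power_mult_distrib mult.commute)
    also have "\<dots> \<le> (norm c)\<^sup>2 * (2 * (1 + norm x)\<^sup>2)"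
      by (intro mult_left_mono) (auto simp: power2_sum add_nonneg_nonneg)
    finally show "\<bar>(x \<bullet> c)\<^sup>2\<bar> \<le> 2 * (norm c)\<^sup>2 * (1 + norm x)\<^sup>2" by simp
    have "norm ((2 * (x \<bullet> c)) *\<^sub>R c) \<le> 2 * (norm x * norm c) * norm c"
      using mult_right_mono[OF cs, of "2 * norm c"] by (simp add: abs_mult mult_ac)
    also have "\<dots> = 2 * (norm c)\<^sup>2 * norm x" by (simp add: power2_eq_square)
    also have "\<dots> \<le> 2 * (norm c)\<^sup>2 * (1 + norm x)\<^sup>2"
      by (intro mult_left_mono) (auto simp: power2_sum add_nonneg_nonneg)
    finally show "norm ((2 * (x \<bullet> c)) *\<^sub>R c) \<le> 2 * (norm c)\<^sup>2 * (1 + norm x)\<^sup>2" .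
    show "((2 * (x \<bullet> c)) *\<^sub>R c) \<bullet> x = 2 * (x \<bullet> c)\<^sup>2"
      by (simp add: power2_eq_square inner_commute)
  qed
  then show ?thesis by (simp add: expectation_inner_square)
qed

end

subsection \<open>Noisy finite differences along a Gaussian direction\<close>

text \<open>A class closed under sums, differences, products and powers: integrability of every
  polynomial in \<open>f (x + \<mu> U)\<close>, \<open>norm U\<close> and inner products with
  \<open>U\<close> then follows by applying closure rules.\<close>

definition poly_growth :: "('a::real_normed_vector \<Rightarrow> real) \<Rightarrow> bool" where
  "poly_growth F \<longleftrightarrow> F \<in> borel_measurable borel \<and> (\<exists>C k. \<forall>x. \<bar>F x\<bar> \<le> C * (1 + norm x) ^ k)"

lemma poly_growthI:
  "F \<in> borel_measurable borel \<Longrightarrow> (\<And>x. \<bar>F x\<bar> \<le> C * (1 + norm x) ^ k) \<Longrightarrow> poly_growth F"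
  unfolding poly_growth_def by blast

lemma poly_growth_const: "poly_growth (\<lambda>_. c)"
  by (rule poly_growthI[where C = "\<bar>c\<bar>" and k = 0]) auto

lemma poly_growth_norm: "poly_growth norm"
  by (rule poly_growthI[where C = 1 and k = 1]) auto

lemma poly_growth_inner: "poly_growth (\<lambda>x::'a::euclidean_space. x \<bullet> c)"
proof (rule poly_growthI)
  fix x :: 'a
  have "\<bar>x \<bullet> c\<bar> \<le> norm x * norm c" by (rule Cauchy_Schwarz_ineq2)
  also have "\<dots> \<le> norm c * (1 + norm x) ^ 1" by (simp add: algebra_simps)
  finally show "\<bar>x \<bullet> c\<bar> \<le> norm c * (1 + norm x) ^ 1" .
qed simp

lemma poly_growth_mult:
  fixes F G :: "'a::real_normed_vector \<Rightarrow> real"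
  assumes "poly_growth F" "poly_growth G"
  shows "poly_growth (\<lambda>x. F x * G x)"
proof -
  obtain C k D l where [measurable]: "F \<in> borel_measurable borel" "G \<in> borel_measurable borel"
    and b: "\<And>x. \<bar>F x\<bar> \<le> C * (1 + norm x) ^ k" "\<And>x. \<bar>G x\<bar> \<le> D * (1 + norm x) ^ l"
    using assms unfolding poly_growth_def by blast
  show ?thesis
  proof (rule poly_growthI)
    fix x :: 'a
    have "\<bar>F x * G x\<bar> \<le> (C * (1 + norm x) ^ k) * (D * (1 + norm x) ^ l)"
      unfolding abs_mult using b[of x] by (intro mult_mono) (auto intro: order_trans[OF abs_ge_zero])
    then show "\<bar>F x * G x\<bar> \<le> (C * D) * (1 + norm x) ^ (k + l)"
      by (simp add: power_add mult_ac)
  qed simp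
qed

lemma poly_growth_power: "poly_growth F \<Longrightarrow> poly_growth (\<lambda>x. F x ^ k)"
  by (induction k) (auto intro: poly_growth_mult poly_growth_const)

lemma poly_growth_add:
  fixes F G :: "'a::real_normed_vector \<Rightarrow> real"
  assumes "poly_growth F" "poly_growth G"
  shows "poly_growth (\<lambda>x. F x + G x)"
proof -
  obtain C k D l where [measurable]: "F \<in> borel_measurable borel" "G \<in> borel_measurable borel"
    and b: "\<And>x. \<bar>F x\<bar> \<le> C * (1 + norm x) ^ k" "\<And>x. \<bar>G x\<bar> \<le> D * (1 + norm x) ^ l"
    using assms unfolding poly_growth_def by blast
  have CD: "0 \<le> C" "0 \<le> D" using b[of 0] by auto
  show ?thesis
  proof (rule poly_growthI)
    fix x :: 'a
    have "C * (1 + norm x) ^ k \<le> C * (1 + norm x) ^ (k + l)" "D * (1 + norm x) ^ l \<le> D * (1 + norm x) ^ (k + l)"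
      using CD by (auto intro!: mult_left_mono power_increasing)
    then show "\<bar>F x + G x\<bar> \<le> (C + D) * (1 + norm x) ^ (k + l)"
      using b[of x] abs_triangle_ineq[of "F x" "G x"] unfolding distrib_right by linarith
  qed simp
qed

lemma poly_growth_diff: "poly_growth F \<Longrightarrow> poly_growth G \<Longrightarrow> poly_growth (\<lambda>x. F x - G x)"
  using poly_growth_add[of F "\<lambda>x. - 1 * G x"] poly_growth_mult[OF poly_growth_const[of "-1"], of G] by simp

lemma poly_growth_lipschitz_affine:
  fixes f :: "'a::euclidean_space \<Rightarrow> real"
  assumes lip: "\<And>x y. \<bar>f x - f y\<bar> \<le> L * norm (x - y)"
    and [measurable]: "f \<in> borel_measurable borel"
  shows "poly_growth (\<lambda>y. f (x + \<mu> *\<^sub>R y))"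
proof (rule poly_growthI)
  fix y :: 'a
  have "L * norm (\<mu> *\<^sub>R y) \<le> \<bar>L * \<mu>\<bar> * norm y" by (simp add: abs_mult mult.assoc[symmetric] mult_right_mono)
  then have "\<bar>f (x + \<mu> *\<^sub>R y)\<bar> \<le> \<bar>f x\<bar> + \<bar>L * \<mu>\<bar> * norm y"
    using lip[of "x + \<mu> *\<^sub>R y" x] by simp
  also have "\<dots> \<le> (\<bar>f x\<bar> + \<bar>L * \<mu>\<bar>) * (1 + norm y) ^ 1"
    by (simp add: algebra_simps)
  finally show "\<bar>f (x + \<mu> *\<^sub>R y)\<bar> \<le> (\<bar>f x\<bar> + \<bar>L * \<mu>\<bar>) * (1 + norm y) ^ 1" .
qed simp

lemmas poly_growth_intros = poly_growth_const poly_growth_norm poly_growth_inner poly_growth_mult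
  poly_growth_power poly_growth_add poly_growth_diff

lemma (in gaussian_vector) integrable_poly_growth': "poly_growth F \<Longrightarrow> integrable M (\<lambda>\<omega>. F (U \<omega>))"
  unfolding poly_growth_def by (auto intro: integrable_poly_growth)

text \<open>One step seen with point and radius fixed. \<open>v False\<close> is the noise at the
  shifted point and \<open>v True\<close> the noise at the current point; the sum type states their
  joint independence from the coordinates of the direction.\<close>

locale noisy_gaussian = gaussian_vector M U for M :: "'w measure" and U :: "'w \<Rightarrow> real^'n" +
  fixes v :: "bool \<Rightarrow> 'w \<Rightarrow> real" and a \<sigma> :: real
  assumes indep_noise: "indep_vars (\<lambda>_. borel) (case_sum (\<lambda>i \<omega>. U \<omega> $ i) v) UNIV"
    and bounded_noise: "\<And>b. AE \<omega> in M. \<bar>v b \<omega>\<bar> \<le> a"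
    and mean_noise: "\<And>b. expectation (v b) = 0"
    and variance_noise: "\<And>b. expectation (\<lambda>\<omega>. (v b \<omega>)\<^sup>2) = \<sigma>\<^sup>2"
begin

lemma measurable_noise [measurable]: "v b \<in> borel_measurable M"
proof -
  have "case_sum (\<lambda>i \<omega>. U \<omega> $ i) v (Inr b) \<in> borel_measurable M"
    using indep_noise unfolding indep_vars_def by blast
  then show ?thesis by simp
qed

text \<open>The coordinates of the direction and the two noises are disjoint blocks of one
  independent family. Choosing \<open>c\<close> as a projection, its square or the product covers
  every noise monomial of the squared step.\<close>

lemma indep_direction_noise:
  fixes B :: "real^'n \<Rightarrow> real"
  assumes [measurable]: "B \<in> borel_measurable borel" "c \<in> borel_measurable (borel \<Otimes>\<^sub>M borel)"
  shows "indep_var borel (\<lambda>\<omega>. B (U \<omega>)) borel (\<lambda>\<omega>. c (v False \<omega>, v True \<omega>))"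
proof -
  let ?V = "\<lambda>j \<omega>. case_sum (\<lambda>i \<omega>. U \<omega> $ i) v j \<omega>"
  have "indep_var (Pi\<^sub>M (range Inl) (\<lambda>_. borel)) (\<lambda>\<omega>. restrict (\<lambda>j. ?V j \<omega>) (range Inl))
      (Pi\<^sub>M (range Inr) (\<lambda>_. borel)) (\<lambda>\<omega>. restrict (\<lambda>j. ?V j \<omega>) (range Inr))"
    by (rule indep_var_restrict[OF indep_noise]) auto
  then have "indep_var borel ((\<lambda>p. B (\<chi> i. p (Inl i))) \<circ> (\<lambda>\<omega>. restrict (\<lambda>j. ?V j \<omega>) (range Inl)))
      borel ((\<lambda>p. c (p (Inr False), p (Inr True))) \<circ> (\<lambda>\<omega>. restrict (\<lambda>j. ?V j \<omega>) (range Inr)))"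
  proof (rule indep_var_compose)
    have [measurable]: "(\<lambda>p. \<chi> i. p (Inl i)) \<in> Pi\<^sub>M (range Inl) (\<lambda>_. borel) \<rightarrow>\<^sub>M (borel :: (real^'n) measure)"
      by (rule borel_measurable_vec_lambda) simp
    show "(\<lambda>p. B (\<chi> i. p (Inl i))) \<in> borel_measurable (Pi\<^sub>M (range Inl) (\<lambda>_. borel))"
      by measurable
    have "(\<lambda>p. (p (Inr False), p (Inr True))) \<in> Pi\<^sub>M (range Inr) (\<lambda>_. borel :: real measure) \<rightarrow>\<^sub>M borel \<Otimes>\<^sub>M borel"
      by (intro measurable_Pair measurable_component_singleton) auto
    then show "(\<lambda>p. c (p (Inr False), p (Inr True))) \<in> borel_measurable (Pi\<^sub>M (range Inr) (\<lambda>_. borel))"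
      by (rule measurable_compose) simp
  qed
  then show ?thesis by (simp add: comp_def rangeI)
qed

lemma integrable_noise: "integrable M (v b)"
  using bounded_noise[of b] by (intro integrable_const_bound[where B = a]) auto

lemma integrable_noise_square: "integrable M (\<lambda>\<omega>. (v b \<omega>)\<^sup>2)"
proof (rule integrable_const_bound[where B = "a\<^sup>2"])
  show "AE \<omega> in M. norm ((v b \<omega>)\<^sup>2) \<le> a\<^sup>2"
    using bounded_noise[of b]
  proof eventually_elim
    case (elim \<omega>)
    then have "\<bar>v b \<omega>\<bar>\<^sup>2 \<le> a\<^sup>2" by (intro power_mono) auto
    then show ?case by simp
  qed
qed simp

lemma indep_noise_pair: "indep_var borel (v False) borel (v True)"
proof -
  let ?V = "\<lambda>j \<omega>. case_sum (\<lambda>i \<omega>. U \<omega> $ i) v j \<omega>"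
  have "indep_var borel ((\<lambda>p. p (Inr False)) \<circ> (\<lambda>\<omega>. restrict (\<lambda>j. ?V j \<omega>) {Inr False}))
      borel ((\<lambda>p. p (Inr True)) \<circ> (\<lambda>\<omega>. restrict (\<lambda>j. ?V j \<omega>) {Inr True}))"
    by (rule indep_var_compose[OF indep_var_restrict[OF indep_noise]]) auto
  then show ?thesis by (simp add: comp_def)
qed

section \<open>Averages of noise monomials with coefficients depending on the direction\<close>

context
  fixes B :: "real^'n \<Rightarrow> real"
  assumes B: "poly_growth B"
begin

lemma B_meas: "B \<in> borel_measurable borel"
  using B by (simp add: poly_growth_def)

lemma noise_linear:
  "integrable M (\<lambda>\<omega>. B (U \<omega>) * v b \<omega>)" "expectation (\<lambda>\<omega>. B (U \<omega>) * v b \<omega>) = 0"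
proof -
  have *: "indep_var borel (\<lambda>\<omega>. B (U \<omega>)) borel (v b)"
    using indep_direction_noise[OF B_meas, of fst] indep_direction_noise[OF B_meas, of snd]
    by (cases b) (simp_all add: eta_contract_eq)
  show "integrable M (\<lambda>\<omega>. B (U \<omega>) * v b \<omega>)"
    by (rule indep_var_integrable[OF * integrable_poly_growth'[OF B] integrable_noise])
  show "expectation (\<lambda>\<omega>. B (U \<omega>) * v b \<omega>) = 0"
    by (subst indep_var_lebesgue_integral[OF * integrable_poly_growth'[OF B] integrable_noise])
      (simp add: mean_noise)
qed

lemma noise_square:
  "integrable M (\<lambda>\<omega>. B (U \<omega>) * (v b \<omega>)\<^sup>2)"
  "expectation (\<lambda>\<omega>. B (U \<omega>) * (v b \<omega>)\<^sup>2) = \<sigma>\<^sup>2 * expectation (\<lambda>\<omega>. B (U \<omega>))"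
proof -
  have *: "indep_var borel (\<lambda>\<omega>. B (U \<omega>)) borel (\<lambda>\<omega>. (v b \<omega>)\<^sup>2)"
    using indep_direction_noise[OF B_meas, of "\<lambda>p. (fst p)\<^sup>2"] indep_direction_noise[OF B_meas, of "\<lambda>p. (snd p)\<^sup>2"]
    by (cases b) simp_all
  show "integrable M (\<lambda>\<omega>. B (U \<omega>) * (v b \<omega>)\<^sup>2)"
    by (rule indep_var_integrable[OF * integrable_poly_growth'[OF B] integrable_noise_square])
  show "expectation (\<lambda>\<omega>. B (U \<omega>) * (v b \<omega>)\<^sup>2) = \<sigma>\<^sup>2 * expectation (\<lambda>\<omega>. B (U \<omega>))"
    by (subst indep_var_lebesgue_integral[OF * integrable_poly_growth'[OF B] integrable_noise_square])
      (simp add: variance_noise)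
qed

lemma noise_cross:
  "integrable M (\<lambda>\<omega>. B (U \<omega>) * (v False \<omega> * v True \<omega>))"
  "expectation (\<lambda>\<omega>. B (U \<omega>) * (v False \<omega> * v True \<omega>)) = 0"
proof -
  have *: "indep_var borel (\<lambda>\<omega>. B (U \<omega>)) borel (\<lambda>\<omega>. v False \<omega> * v True \<omega>)"
    using indep_direction_noise[OF B_meas, of "\<lambda>p. fst p * snd p"] by simp
  have i: "integrable M (\<lambda>\<omega>. v False \<omega> * v True \<omega>)"
    by (rule indep_var_integrable[OF indep_noise_pair integrable_noise integrable_noise])
  have e: "expectation (\<lambda>\<omega>. v False \<omega> * v True \<omega>) = 0"
    by (subst indep_var_lebesgue_integral[OF indep_noise_pair integrable_noise integrable_noise])
      (simp add: mean_noise)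
  show "integrable M (\<lambda>\<omega>. B (U \<omega>) * (v False \<omega> * v True \<omega>))"
    by (rule indep_var_integrable[OF * integrable_poly_growth'[OF B] i])
  show "expectation (\<lambda>\<omega>. B (U \<omega>) * (v False \<omega> * v True \<omega>)) = 0"
    by (subst indep_var_lebesgue_integral[OF * integrable_poly_growth'[OF B] i]) (simp add: e)
qed

end

text \<open>Expanded, the square is a polynomial of degree two in the two noises with coefficients
  depending on \<open>U\<close>. Linear and mixed noise terms average to 0, squares to
  \<open>\<sigma>^2\<close>, and \<open>c * (U \<bullet> w)\<close> drops out because
  \<open>U\<close> is centred. It is applied with \<open>A y = f (x + \<mu> y)\<close>,
  \<open>c = f x\<close> and \<open>\<eta> = h / \<mu>\<close>.\<close>

lemma zo_step_expectation:
  fixes A :: "real^'n \<Rightarrow> real" and c \<eta> :: real and w :: "real^'n"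
  assumes A: "poly_growth A"
  defines "\<Delta> \<equiv> \<lambda>\<omega>. A (U \<omega>) * (1 + v False \<omega>) - c * (1 + v True \<omega>)"
  shows "integrable M (\<lambda>\<omega>. (norm (w - (\<eta> * \<Delta> \<omega>) *\<^sub>R U \<omega>))\<^sup>2)"
    and "expectation (\<lambda>\<omega>. (norm (w - (\<eta> * \<Delta> \<omega>) *\<^sub>R U \<omega>))\<^sup>2)
      = (norm w)\<^sup>2 - 2 * \<eta> * expectation (\<lambda>\<omega>. A (U \<omega>) * (U \<omega> \<bullet> w))
        + \<eta>\<^sup>2 * expectation (\<lambda>\<omega>. (norm (U \<omega>))\<^sup>2 * ((A (U \<omega>) - c)\<^sup>2 + \<sigma>\<^sup>2 * ((A (U \<omega>))\<^sup>2 + c\<^sup>2)))"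
proof -
  \<comment> \<open>\<open>P\<close> is the noise-free part, \<open>Q1\<close> and \<open>Q2\<close>
    are the coefficients of the squared noises, \<open>R1\<close> and \<open>R2\<close> those of the
    single noises, \<open>S\<close> that of their product.\<close>
  define P where "P x = (norm w)\<^sup>2 - 2 * \<eta> * (A x * (x \<bullet> w) - c * (x \<bullet> w)) + \<eta>\<^sup>2 * ((norm x)\<^sup>2 * (A x - c)\<^sup>2)" for x
  define Q1 where "Q1 x = \<eta>\<^sup>2 * ((norm x)\<^sup>2 * (A x)\<^sup>2)" for x
  define Q2 where "Q2 x = \<eta>\<^sup>2 * ((norm x)\<^sup>2 * c\<^sup>2)" for x :: "real^'n"
  define R1 where "R1 x = \<eta>\<^sup>2 * ((norm x)\<^sup>2 * (2 * (A x - c) * A x)) - 2 * \<eta> * (A x * (x \<bullet> w))" for x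
  define R2 where "R2 x = 2 * \<eta> * (c * (x \<bullet> w)) - \<eta>\<^sup>2 * ((norm x)\<^sup>2 * (2 * (A x - c) * c))" for x
  define S where "S x = - (\<eta>\<^sup>2 * ((norm x)\<^sup>2 * (2 * A x * c)))" for x
  \<comment> \<open>The sign becomes a factor because the growth rules cover products but not
    negation.\<close>
  have S_alt: "S = (\<lambda>x. (- 1) * (\<eta>\<^sup>2 * ((norm x)\<^sup>2 * (2 * A x * c))))" by (auto simp: S_def)
  have g: "poly_growth P" "poly_growth Q1" "poly_growth Q2" "poly_growth R1" "poly_growth R2" "poly_growth S"
    unfolding P_def[abs_def] Q1_def[abs_def] Q2_def[abs_def] R1_def[abs_def] R2_def[abs_def] S_alt
    by (intro poly_growth_intros A)+
  have eq: "(norm (w - (\<eta> * \<Delta> \<omega>) *\<^sub>R U \<omega>))\<^sup>2 = P (U \<omega>) + Q1 (U \<omega>) * (v False \<omega>)\<^sup>2 + Q2 (U \<omega>) * (v True \<omega>)\<^sup>2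
      + R1 (U \<omega>) * v False \<omega> + R2 (U \<omega>) * v True \<omega> + S (U \<omega>) * (v False \<omega> * v True \<omega>)" for \<omega>
  proof -
    have "(norm (w - (\<eta> * \<Delta> \<omega>) *\<^sub>R U \<omega>))\<^sup>2 = (norm w)\<^sup>2 - 2 * (\<eta> * \<Delta> \<omega>) * (U \<omega> \<bullet> w) + (\<eta> * \<Delta> \<omega>)\<^sup>2 * (norm (U \<omega>))\<^sup>2"
      unfolding power2_norm_eq_inner
      by (simp add: inner_diff_left inner_diff_right inner_commute power2_eq_square)
    also have "\<dots> = P (U \<omega>) + Q1 (U \<omega>) * (v False \<omega>)\<^sup>2 + Q2 (U \<omega>) * (v True \<omega>)\<^sup>2
      + R1 (U \<omega>) * v False \<omega> + R2 (U \<omega>) * v True \<omega> + S (U \<omega>) * (v False \<omega> * v True \<omega>)"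
      unfolding P_def Q1_def Q2_def R1_def R2_def S_def \<Delta>_def by algebra
    finally show ?thesis .
  qed
  note int = integrable_poly_growth'[OF g(1)] noise_square(1)[OF g(2), of False] noise_square(1)[OF g(3), of True]
    noise_linear(1)[OF g(4), of False] noise_linear(1)[OF g(5), of True] noise_cross(1)[OF g(6)]
  show "integrable M (\<lambda>\<omega>. (norm (w - (\<eta> * \<Delta> \<omega>) *\<^sub>R U \<omega>))\<^sup>2)"
    unfolding eq by (intro Bochner_Integration.integrable_add int)
  have "expectation (\<lambda>\<omega>. (norm (w - (\<eta> * \<Delta> \<omega>) *\<^sub>R U \<omega>))\<^sup>2)
      = expectation (\<lambda>\<omega>. P (U \<omega>)) + \<sigma>\<^sup>2 * expectation (\<lambda>\<omega>. Q1 (U \<omega>)) + \<sigma>\<^sup>2 * expectation (\<lambda>\<omega>. Q2 (U \<omega>))"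
    unfolding eq using int
    by (simp add: noise_square(2)[OF g(2)] noise_square(2)[OF g(3)] noise_linear(2)[OF g(4)]
        noise_linear(2)[OF g(5)] noise_cross(2)[OF g(6)])
  also have "\<dots> = expectation (\<lambda>\<omega>. P (U \<omega>) + \<sigma>\<^sup>2 * Q1 (U \<omega>) + \<sigma>\<^sup>2 * Q2 (U \<omega>))"
    using g by (simp add: integrable_poly_growth')
  also have "\<dots> = expectation (\<lambda>\<omega>. (norm w)\<^sup>2 - 2 * \<eta> * (A (U \<omega>) * (U \<omega> \<bullet> w)) + 2 * \<eta> * c * (U \<omega> \<bullet> w)
      + \<eta>\<^sup>2 * ((norm (U \<omega>))\<^sup>2 * ((A (U \<omega>) - c)\<^sup>2 + \<sigma>\<^sup>2 * ((A (U \<omega>))\<^sup>2 + c\<^sup>2))))"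
    unfolding P_def Q1_def Q2_def by (simp add: algebra_simps)
  also have "\<dots> = (norm w)\<^sup>2 - 2 * \<eta> * expectation (\<lambda>\<omega>. A (U \<omega>) * (U \<omega> \<bullet> w))
        + \<eta>\<^sup>2 * expectation (\<lambda>\<omega>. (norm (U \<omega>))\<^sup>2 * ((A (U \<omega>) - c)\<^sup>2 + \<sigma>\<^sup>2 * ((A (U \<omega>))\<^sup>2 + c\<^sup>2)))"
  proof -
    have "integrable M (\<lambda>\<omega>. A (U \<omega>) * (U \<omega> \<bullet> w))" "integrable M (\<lambda>\<omega>. U \<omega> \<bullet> w)"
      "integrable M (\<lambda>\<omega>. (norm (U \<omega>))\<^sup>2 * ((A (U \<omega>) - c)\<^sup>2 + \<sigma>\<^sup>2 * ((A (U \<omega>))\<^sup>2 + c\<^sup>2)))"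
      by (intro integrable_poly_growth' poly_growth_intros A)+
    then show ?thesis by (simp add: expectation_inner prob_space)
  qed
  finally show "expectation (\<lambda>\<omega>. (norm (w - (\<eta> * \<Delta> \<omega>) *\<^sub>R U \<omega>))\<^sup>2)
      = (norm w)\<^sup>2 - 2 * \<eta> * expectation (\<lambda>\<omega>. A (U \<omega>) * (U \<omega> \<bullet> w))
        + \<eta>\<^sup>2 * expectation (\<lambda>\<omega>. (norm (U \<omega>))\<^sup>2 * ((A (U \<omega>) - c)\<^sup>2 + \<sigma>\<^sup>2 * ((A (U \<omega>))\<^sup>2 + c\<^sup>2)))" .
qed

end

section \<open>Smoothing estimates for a fixed point and radius\<close>

context gaussian_vector
begin

context
  fixes f :: "real^'n \<Rightarrow> real" and g :: "real^'n \<Rightarrow> real^'n" and L0 L1 :: real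
  assumes grad: "\<And>x. (f has_derivative (\<lambda>d. g x \<bullet> d)) (at x)"
    and lipf: "\<And>x y. \<bar>f x - f y\<bar> \<le> L0 * norm (x - y)"
    and lipg: "\<And>x y. norm (g x - g y) \<le> L1 * norm (x - y)"
begin

lemma continuous_f: "continuous_on UNIV f"
  using grad by (auto intro!: has_derivative_continuous simp: continuous_on_eq_continuous_at)

lemma poly_growth_f: "poly_growth (\<lambda>y. f (x + \<mu> *\<^sub>R y))"
  by (intro poly_growth_lipschitz_affine[OF lipf] borel_measurable_continuous_onI continuous_f)

text \<open>Stein's identity for \<open>y \<mapsto> f (x + \<mu> y)\<close> turns the right side
  into the mean of \<open>\<mu> g (x + \<mu> U) \<bullet> (x - z)\<close>. Both \<open>x\<close> and
  \<open>z\<close> are shifted by \<open>\<mu> U\<close> before convexity is used, so the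
  displacement stays \<open>x - z\<close>; the price is only the excess of
  \<open>f (z + \<mu> U)\<close> over \<open>f z\<close>, on average at most
  \<open>L1 * \<mu>^2 * n / 2\<close>.\<close>

lemma smoothed_gradient_inner:
  assumes convex: "convex_on UNIV f" and cont: "continuous_on UNIV g" and mu: "0 < \<mu>"
  shows "\<mu> * (f x - f z - L1 / 2 * \<mu>\<^sup>2 * real CARD('n))
    \<le> expectation (\<lambda>\<omega>. f (x + \<mu> *\<^sub>R U \<omega>) * (U \<omega> \<bullet> (x - z)))"
proof -
  \<comment> \<open>The Lipschitz bound at a unit vector and the origin forces the sign;
    \<open>axis undefined 1\<close> is an arbitrary unit vector.\<close>
  have L1: "0 \<le> L1"
    using order_trans[OF norm_ge_zero lipg[of "axis undefined 1" 0]] by simp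
  obtain C k where C: "\<And>y. \<bar>f (x + \<mu> *\<^sub>R y)\<bar> \<le> C * (1 + norm y) ^ k"
    using poly_growth_f[of x \<mu>] unfolding poly_growth_def by blast
  have C0: "0 \<le> C" using C[of 0] by simp
  define D where "D = \<mu> * (norm (g x) + L1 * \<mu>)"
  have D0: "0 \<le> D" using mu L1 by (simp add: D_def)
  have D: "norm (\<mu> *\<^sub>R g (x + \<mu> *\<^sub>R y)) \<le> D * (1 + norm y) ^ 1" for y
  proof -
    have "norm (g (x + \<mu> *\<^sub>R y)) \<le> norm (g x) + L1 * \<mu> * norm y"
      using lipg[of "x + \<mu> *\<^sub>R y" x] norm_triangle_ineq2[of "g (x + \<mu> *\<^sub>R y)" "g x"] mu by simp
    also have "\<dots> \<le> (norm (g x) + L1 * \<mu>) * (1 + norm y) ^ 1"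
      using L1 mu by (simp add: algebra_simps)
    finally have "\<mu> * norm (g (x + \<mu> *\<^sub>R y)) \<le> \<mu> * ((norm (g x) + L1 * \<mu>) * (1 + norm y) ^ 1)"
      using mu by (intro mult_left_mono) auto
    then show ?thesis using mu by (simp add: D_def mult.assoc)
  qed
  have pow: "(1 + norm y) ^ k \<le> (1 + norm y) ^ (k + 1)" "(1 + norm y) ^ 1 \<le> (1 + norm y) ^ (k + 1)" for y :: "real^'n"
    by (intro power_increasing; simp)+
  have stein: "expectation (\<lambda>\<omega>. (\<mu> *\<^sub>R g (x + \<mu> *\<^sub>R U \<omega>)) \<bullet> (x - z)) = expectation (\<lambda>\<omega>. f (x + \<mu> *\<^sub>R U \<omega>) * (U \<omega> \<bullet> (x - z)))"
  proof (rule stein[where C = "C + D" and k = "k + 1"])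
    fix y :: "real^'n"
    have "((\<lambda>y. f (x + \<mu> *\<^sub>R y)) has_derivative (\<lambda>d. g (x + \<mu> *\<^sub>R y) \<bullet> (\<mu> *\<^sub>R d))) (at y)"
      by (rule has_derivative_compose[OF _ grad]) (auto intro!: derivative_eq_intros)
    then show "((\<lambda>y. f (x + \<mu> *\<^sub>R y)) has_derivative (\<lambda>d. (\<mu> *\<^sub>R g (x + \<mu> *\<^sub>R y)) \<bullet> d)) (at y)"
      by simp
    have "C * (1 + norm y) ^ k \<le> (C + D) * (1 + norm y) ^ (k + 1)"
      using C0 D0 pow[of y] by (intro mult_mono) auto
    then show "\<bar>f (x + \<mu> *\<^sub>R y)\<bar> \<le> (C + D) * (1 + norm y) ^ (k + 1)" using C[of y] by linarith
    have "D * (1 + norm y) ^ 1 \<le> (C + D) * (1 + norm y) ^ (k + 1)"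
      using C0 D0 pow[of y] by (intro mult_mono) auto
    then show "norm (\<mu> *\<^sub>R g (x + \<mu> *\<^sub>R y)) \<le> (C + D) * (1 + norm y) ^ (k + 1)" using D[of y] by linarith
  next
    show "continuous_on UNIV (\<lambda>y. \<mu> *\<^sub>R g (x + \<mu> *\<^sub>R y))"
      by (intro continuous_intros continuous_on_compose2[OF cont]) auto
  qed
  have [measurable]: "g \<in> borel_measurable borel"
    using cont by (rule borel_measurable_continuous_onI)
  \<comment> \<open>The term \<open>U \<bullet> (g x - g z)\<close> has mean 0. It is inserted
    because the inequality holds pointwise only with both first-order terms present.\<close>
  have "\<mu> * (f x - f z - L1 / 2 * \<mu>\<^sup>2 * real CARD('n))
      = expectation (\<lambda>\<omega>. \<mu> * (f x - f z + \<mu> * (U \<omega> \<bullet> (g x - g z)) - L1 / 2 * \<mu>\<^sup>2 * (norm (U \<omega>))\<^sup>2))"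
  proof -
    have "integrable M (\<lambda>\<omega>. U \<omega> \<bullet> (g x - g z))" "integrable M (\<lambda>\<omega>. (norm (U \<omega>))\<^sup>2)"
      by (intro integrable_poly_growth' poly_growth_intros)+
    then show ?thesis by (simp add: expectation_inner expectation_norm_square prob_space)
  qed
  also have "\<dots> \<le> expectation (\<lambda>\<omega>. (\<mu> *\<^sub>R g (x + \<mu> *\<^sub>R U \<omega>)) \<bullet> (x - z))"
  proof (rule integral_mono)
    show "integrable M (\<lambda>\<omega>. \<mu> * (f x - f z + \<mu> * (U \<omega> \<bullet> (g x - g z)) - L1 / 2 * \<mu>\<^sup>2 * (norm (U \<omega>))\<^sup>2))"
      by (intro integrable_poly_growth' poly_growth_intros)
    show "integrable M (\<lambda>\<omega>. (\<mu> *\<^sub>R g (x + \<mu> *\<^sub>R U \<omega>)) \<bullet> (x - z))"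
    proof (rule integrable_poly_growth)
      fix y :: "real^'n"
      have "\<bar>(\<mu> *\<^sub>R g (x + \<mu> *\<^sub>R y)) \<bullet> (x - z)\<bar> \<le> norm (\<mu> *\<^sub>R g (x + \<mu> *\<^sub>R y)) * norm (x - z)"
        by (rule Cauchy_Schwarz_ineq2)
      also have "\<dots> \<le> (D * (1 + norm y) ^ 1) * norm (x - z)" by (intro mult_right_mono D) simp
      finally show "\<bar>(\<mu> *\<^sub>R g (x + \<mu> *\<^sub>R y)) \<bullet> (x - z)\<bar> \<le> (D * norm (x - z)) * (1 + norm y) ^ 1"
        by (simp add: mult_ac)
    qed simp
    fix \<omega>
    let ?u = "U \<omega>"
    have "f (x + \<mu> *\<^sub>R ?u) + g (x + \<mu> *\<^sub>R ?u) \<bullet> (z + \<mu> *\<^sub>R ?u - (x + \<mu> *\<^sub>R ?u)) \<le> f (z + \<mu> *\<^sub>R ?u)"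
      by (rule convex_gradient_below[OF grad convex])
    moreover have "g (x + \<mu> *\<^sub>R ?u) \<bullet> (z + \<mu> *\<^sub>R ?u - (x + \<mu> *\<^sub>R ?u)) = - (g (x + \<mu> *\<^sub>R ?u) \<bullet> (x - z))"
      by (simp add: inner_diff_right)
    moreover have "f x + g x \<bullet> (\<mu> *\<^sub>R ?u) \<le> f (x + \<mu> *\<^sub>R ?u)"
      using convex_gradient_below[OF grad convex, of x "x + \<mu> *\<^sub>R ?u"] by simp
    moreover have "f (z + \<mu> *\<^sub>R ?u) \<le> f z + g z \<bullet> (\<mu> *\<^sub>R ?u) + L1 / 2 * (norm (\<mu> *\<^sub>R ?u))\<^sup>2"
      by (rule gradient_lipschitz_upper[OF grad lipg])
    moreover have "\<mu> * (?u \<bullet> (g x - g z)) = g x \<bullet> (\<mu> *\<^sub>R ?u) - g z \<bullet> (\<mu> *\<^sub>R ?u)"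
      by (simp add: inner_diff_right inner_commute algebra_simps)
    moreover have "L1 / 2 * \<mu>\<^sup>2 * (norm ?u)\<^sup>2 = L1 / 2 * (norm (\<mu> *\<^sub>R ?u))\<^sup>2"
      by (simp add: power_mult_distrib)
    ultimately have "f x - f z + \<mu> * (?u \<bullet> (g x - g z)) - L1 / 2 * \<mu>\<^sup>2 * (norm ?u)\<^sup>2 \<le> g (x + \<mu> *\<^sub>R ?u) \<bullet> (x - z)"
      by linarith
    then have "\<mu> * (f x - f z + \<mu> * (?u \<bullet> (g x - g z)) - L1 / 2 * \<mu>\<^sup>2 * (norm ?u)\<^sup>2) \<le> \<mu> * (g (x + \<mu> *\<^sub>R ?u) \<bullet> (x - z))"
      using mu by (intro mult_left_mono) auto
    then show "\<mu> * (f x - f z + \<mu> * (?u \<bullet> (g x - g z)) - L1 / 2 * \<mu>\<^sup>2 * (norm ?u)\<^sup>2) \<le> (\<mu> *\<^sub>R g (x + \<mu> *\<^sub>R ?u)) \<bullet> (x - z)"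
      by simp
  qed
  also note stein
  finally show ?thesis .
qed

text \<open>The increment of \<open>f\<close> is estimated twice. In the noise-free square,
  linearization with a second-order remainder exposes \<open>|g x|^2\<close>, which can be absorbed
  later. In the noise terms the Lipschitz bound is used instead, leaving \<open>3 * (f x)^2\<close>
  plus a term of order \<open>\<mu>^2\<close>. Only this \<open>(f x)^2\<close> part lacks a factor
  \<open>\<mu>^2\<close>.\<close>

lemma smoothed_second_moment:
  fixes \<sigma> \<mu> :: real
  assumes mu: "0 < \<mu>"
  defines "n \<equiv> real CARD('n)"
  shows "expectation (\<lambda>\<omega>. (norm (U \<omega>))\<^sup>2 * ((f (x + \<mu> *\<^sub>R U \<omega>) - f x)\<^sup>2
            + \<sigma>\<^sup>2 * ((f (x + \<mu> *\<^sub>R U \<omega>))\<^sup>2 + (f x)\<^sup>2)))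
    \<le> \<mu>\<^sup>2 * (2 * (n + 2) * (norm (g x))\<^sup>2 + \<mu>\<^sup>2 * L1\<^sup>2 / 2 * (n * (n + 2) * (n + 4))
        + 2 * \<sigma>\<^sup>2 * L0\<^sup>2 * (n * (n + 2))) + 3 * \<sigma>\<^sup>2 * (f x)\<^sup>2 * n"
    (is "expectation (\<lambda>\<omega>. ?l (U \<omega>)) \<le> ?r")
proof -
  let ?b = "\<lambda>y. 2 * \<mu>\<^sup>2 * ((norm y)\<^sup>2 * (y \<bullet> g x)\<^sup>2) + \<mu> ^ 4 * L1\<^sup>2 / 2 * norm y ^ 6
      + 3 * \<sigma>\<^sup>2 * (f x)\<^sup>2 * (norm y)\<^sup>2 + 2 * \<sigma>\<^sup>2 * L0\<^sup>2 * \<mu>\<^sup>2 * norm y ^ 4"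
  have "expectation (\<lambda>\<omega>. ?l (U \<omega>)) \<le> expectation (\<lambda>\<omega>. ?b (U \<omega>))"
  proof (rule integral_mono)
    show "integrable M (\<lambda>\<omega>. ?l (U \<omega>))" "integrable M (\<lambda>\<omega>. ?b (U \<omega>))"
      by (intro integrable_poly_growth' poly_growth_intros poly_growth_f)+
    fix \<omega>
    define y where "y = U \<omega>"
    define A where "A = f (x + \<mu> *\<^sub>R y)"
    define D where "D = A - f x"
    \<comment> \<open>The remainder of the linearization at \<open>x\<close>; upper and lower
      quadratic bounds together control its absolute value.\<close>
    define R where "R = D - \<mu> * (y \<bullet> g x)"
    have "A \<le> f x + g x \<bullet> (\<mu> *\<^sub>R y) + L1 / 2 * (norm (\<mu> *\<^sub>R y))\<^sup>2"
      "f x + g x \<bullet> (\<mu> *\<^sub>R y) - L1 / 2 * (norm (\<mu> *\<^sub>R y))\<^sup>2 \<le> A"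
      unfolding A_def by (rule gradient_lipschitz_upper[OF grad lipg] gradient_lipschitz_lower[OF grad lipg])+
    moreover have "R = A - f x - g x \<bullet> (\<mu> *\<^sub>R y)" by (simp add: R_def D_def inner_commute)
    ultimately have "\<bar>R\<bar> \<le> L1 / 2 * (norm (\<mu> *\<^sub>R y))\<^sup>2" by linarith
    then have "\<bar>R\<bar> \<le> L1 / 2 * (\<mu>\<^sup>2 * (norm y)\<^sup>2)" by (simp add: power_mult_distrib)
    then have "\<bar>R\<bar>\<^sup>2 \<le> (L1 / 2 * (\<mu>\<^sup>2 * (norm y)\<^sup>2))\<^sup>2" by (intro power_mono) auto
    then have R: "R\<^sup>2 \<le> \<mu> ^ 4 * L1\<^sup>2 / 4 * norm y ^ 4"
      by (simp add: power_mult_distrib power_divide mult_ac flip: power_mult)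
    have "D\<^sup>2 = (\<mu> * (y \<bullet> g x) + R)\<^sup>2" by (simp add: R_def)
    also have "\<dots> \<le> 2 * (\<mu> * (y \<bullet> g x))\<^sup>2 + 2 * R\<^sup>2"
      using zero_le_power2[of "\<mu> * (y \<bullet> g x) - R"] by (simp add: power2_sum power2_diff)
    finally have D1: "D\<^sup>2 \<le> 2 * \<mu>\<^sup>2 * (y \<bullet> g x)\<^sup>2 + \<mu> ^ 4 * L1\<^sup>2 / 2 * norm y ^ 4"
      using R by (simp add: power_mult_distrib)
    have "\<bar>D\<bar> \<le> L0 * norm (\<mu> *\<^sub>R y)" using lipf[of "x + \<mu> *\<^sub>R y" x] by (simp add: D_def A_def)
    then have "\<bar>D\<bar>\<^sup>2 \<le> (L0 * norm (\<mu> *\<^sub>R y))\<^sup>2" by (intro power_mono) auto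
    then have D2: "D\<^sup>2 \<le> L0\<^sup>2 * \<mu>\<^sup>2 * (norm y)\<^sup>2" by (simp add: power_mult_distrib mult.assoc)
    have "A\<^sup>2 = (f x + D)\<^sup>2" by (simp add: D_def)
    also have "\<dots> \<le> 2 * (f x)\<^sup>2 + 2 * D\<^sup>2"
      using zero_le_power2[of "f x - D"] by (simp add: power2_sum power2_diff)
    finally have A: "A\<^sup>2 + (f x)\<^sup>2 \<le> 3 * (f x)\<^sup>2 + 2 * (L0\<^sup>2 * \<mu>\<^sup>2 * (norm y)\<^sup>2)" using D2 by simp
    have "?l y = (norm y)\<^sup>2 * (D\<^sup>2 + \<sigma>\<^sup>2 * (A\<^sup>2 + (f x)\<^sup>2))" by (simp add: D_def A_def)
    also have "\<dots> \<le> (norm y)\<^sup>2 * ((2 * \<mu>\<^sup>2 * (y \<bullet> g x)\<^sup>2 + \<mu> ^ 4 * L1\<^sup>2 / 2 * norm y ^ 4)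
        + \<sigma>\<^sup>2 * (3 * (f x)\<^sup>2 + 2 * (L0\<^sup>2 * \<mu>\<^sup>2 * (norm y)\<^sup>2)))"
      by (intro mult_left_mono add_mono D1 A) auto
    also have "\<dots> = ?b y" by (simp add: algebra_simps flip: power_add)
    finally show "?l (U \<omega>) \<le> ?b (U \<omega>)" unfolding y_def .
  qed
  also have "expectation (\<lambda>\<omega>. ?b (U \<omega>)) = 2 * \<mu>\<^sup>2 * ((n + 2) * (norm (g x))\<^sup>2) + \<mu> ^ 4 * L1\<^sup>2 / 2 * (n * (n + 2) * (n + 4))
      + 3 * \<sigma>\<^sup>2 * (f x)\<^sup>2 * n + 2 * \<sigma>\<^sup>2 * L0\<^sup>2 * \<mu>\<^sup>2 * (n * (n + 2))"
  proof -
    have "integrable M (\<lambda>\<omega>. (norm (U \<omega>))\<^sup>2 * (U \<omega> \<bullet> g x)\<^sup>2)" "integrable M (\<lambda>\<omega>. norm (U \<omega>) ^ k)" for k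
      by (intro integrable_poly_growth' poly_growth_intros)+
    then show ?thesis
      by (simp add: expectation_norm_square_inner_square expectation_norm_pow6 expectation_norm_square
          expectation_norm_pow4 n_def)
  qed
  also have "\<dots> = ?r" by algebra
  finally show ?thesis .
qed

end

end

subsection \<open>The iteration\<close>

text \<open>The two sample points may belong to different spaces. This is what lets an iterate be
  rewritten as a function of the finitely many samples used so far.\<close>

lemma zo_iter_cong:
  assumes "\<And>j. j < k \<Longrightarrow> u j \<omega> = u' j \<omega>'" "\<And>j. j < 3 * k \<Longrightarrow> nu j \<omega> = nu' j \<omega>'"
  shows "zo_iter f h C4 x0 u nu k \<omega> = zo_iter f h C4 x0 u' nu' k \<omega>'"
  using assms by (induction k) (simp_all add: Let_def)

lemma borel_measurable_zo_iter:
  assumes f: "f \<in> borel_measurable borel"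
    and "\<And>j. j < k \<Longrightarrow> u j \<in> borel_measurable M" "\<And>j. j < 3 * k \<Longrightarrow> nu j \<in> borel_measurable M"
  shows "zo_iter f h C4 x0 u nu k \<in> borel_measurable M"
  using assms(2,3)
proof (induction k)
  case (Suc k)
  note [measurable] = f
  have [measurable]: "zo_iter f h C4 x0 u nu k \<in> borel_measurable M"
    using Suc.prems by (intro Suc.IH) auto
  have [measurable]: "u k \<in> borel_measurable M" "nu (3 * k) \<in> borel_measurable M"
    "nu (Suc (3 * k)) \<in> borel_measurable M" "nu (Suc (Suc (3 * k))) \<in> borel_measurable M"
    by (auto intro: Suc.prems)
  show ?case unfolding zo_iter.simps Let_def zo_mu_def ftilde_def by simp
next
  case 0
  have "zo_iter f h C4 x0 u nu 0 = (\<lambda>_. x0)" by (rule ext) simp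
  then show ?case by simp
qed

text \<open>Injectivity makes the singletons \<open>{r j}\<close> disjoint blocks, and each block is
  then projected to its only component.\<close>

lemma (in prob_space) indep_vars_reindex:
  assumes "indep_vars M' X I" "inj_on r L" "r ` L \<subseteq> I"
  shows "indep_vars (\<lambda>j. M' (r j)) (\<lambda>j. X (r j)) L"
proof -
  have "indep_vars (\<lambda>j. PiM {r j} M') (\<lambda>j \<omega>. restrict (\<lambda>i. X i \<omega>) {r j}) L"
  proof (rule indep_vars_restrict[OF assms(1)])
    show "disjoint_family_on (\<lambda>j. {r j}) L"
      using assms(2) by (auto simp: disjoint_family_on_def inj_on_eq_iff)
  qed (use assms(3) in auto)
  from indep_vars_compose2[OF this, of "\<lambda>j p. p (r j)" "\<lambda>j. M' (r j)"] show ?thesis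
    by simp
qed

text \<open>The recursion is derived for an arbitrary positive \<open>C4\<close>; only
  \<open>h\<close> has its final value here, as the absorption of the gradient depends on it.
  \<open>z\<close> is the minimizer.\<close>

locale zo_process = prob_space M for M :: "'w measure" +
  fixes f :: "real^'n \<Rightarrow> real" and g :: "real^'n \<Rightarrow> real^'n"
    and L0 L1 a b \<sigma> h C4 :: real and z x0 :: "real^'n"
    and u :: "nat \<Rightarrow> 'w \<Rightarrow> real^'n" and nu :: "nat \<Rightarrow> 'w \<Rightarrow> real"
  assumes convex: "convex_on UNIV f"
    and grad: "\<And>x. (f has_derivative (\<lambda>d. g x \<bullet> d)) (at x)"
    and grad_cont: "continuous_on UNIV g"
    and L1: "L1 > 0"
    and lipf: "\<And>x y. \<bar>f x - f y\<bar> \<le> L0 * norm (x - y)"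
    and lipg: "\<And>x y. norm (g x - g y) \<le> L1 * norm (x - y)"
    and minimizer: "\<And>x. f z \<le> f x"
    and indep: "indep_vars (\<lambda>_. borel) (case_sum (\<lambda>(k, i) \<omega>. u k \<omega> $ i) nu) UNIV"
    and gauss: "\<And>k i. distributed M lborel (\<lambda>\<omega>. u k \<omega> $ i) std_normal_density"
    and ident: "\<And>j. distr M borel (nu j) = distr M borel (nu 0)"
    and a: "a < 1"
    and support: "AE \<omega> in M. \<bar>nu 0 \<omega>\<bar> \<le> a"
    and mean0: "expectation (nu 0) = 0"
    and second_moment: "expectation (\<lambda>\<omega>. (nu 0 \<omega>)\<^sup>2) = \<sigma>\<^sup>2"
    and inv_b: "expectation (\<lambda>\<omega>. 1 / (1 + nu 0 \<omega>)) \<le> b"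
    and h: "h = 1 / (4 * L1 * (real CARD('n) + 4))"
    and C4: "C4 > 0"
    and nonzero: "\<And>k. AE \<omega> in M. f (zo_iter f h C4 x0 u nu k \<omega>) \<noteq> 0"
    and integ: "\<And>k. integrable M (\<lambda>\<omega>. f (zo_iter f h C4 x0 u nu k \<omega>))"
begin

abbreviation "X k \<omega> \<equiv> zo_iter f h C4 x0 u nu k \<omega>"

definition "V = case_sum (\<lambda>(k, i) \<omega>. u k \<omega> $ i) nu"

lemma V_simps: "V (Inl (k, i)) = (\<lambda>\<omega>. u k \<omega> $ i)" "V (Inr j) = nu j"
  by (simp_all add: V_def)

lemma indep_V: "indep_vars (\<lambda>_. borel) V UNIV"
  using indep by (simp add: V_def)

lemma measurable_V [measurable]: "V j \<in> borel_measurable M"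
  using indep_V unfolding indep_vars_def by blast

lemma measurable_nu [measurable]: "nu j \<in> borel_measurable M"
  using measurable_V[of "Inr j"] by (simp only: V_simps)

lemma measurable_u [measurable]: "u k \<in> borel_measurable M"
proof -
  have "(\<lambda>\<omega>. \<chi> i. V (Inl (k, i)) \<omega>) \<in> borel_measurable M"
    by (rule borel_measurable_vec_lambda) (rule measurable_V)
  then show ?thesis by (simp only: V_simps vec_lambda_eta)
qed

lemma measurable_f [measurable]: "f \<in> borel_measurable borel"
  using grad by (intro borel_measurable_continuous_onI)
    (auto intro!: has_derivative_continuous simp: continuous_on_eq_continuous_at)

lemma measurable_X [measurable]: "X k \<in> borel_measurable M"
  by (intro borel_measurable_zo_iter) auto

lemma h_pos: "0 < h"
  using L1 by (simp add: h)

lemma expectation_nu: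
  assumes [measurable]: "c \<in> borel_measurable borel"
  shows "expectation (\<lambda>\<omega>. c (nu j \<omega>) :: real) = expectation (\<lambda>\<omega>. c (nu 0 \<omega>))"
proof -
  have "integral\<^sup>L (distr M borel (nu i)) c = expectation (\<lambda>\<omega>. c (nu i \<omega>))" for i
    by (rule integral_distr) simp_all
  from this[of j] this[of 0] show ?thesis unfolding ident[of j] by (simp only:)
qed

lemma bounded_nu: "AE \<omega> in M. \<bar>nu j \<omega>\<bar> \<le> a"
proof -
  have "(AE t in distr M borel (nu i). \<bar>t\<bar> \<le> a) \<longleftrightarrow> (AE \<omega> in M. \<bar>nu i \<omega>\<bar> \<le> a)" for i
    by (rule AE_distr_iff) simp_all
  from this[of j] this[of 0] support show ?thesis unfolding ident[of j] by (simp only:)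
qed

lemma noisy_gaussian_step: "noisy_gaussian M (u k) (\<lambda>t. nu (if t then 3 * k + 2 else 3 * k + 1)) a \<sigma>"
proof -
  \<comment> \<open>The reindexing selects the coordinates of \<open>u k\<close> and the noises
    \<open>3 * k + 1\<close> and \<open>3 * k + 2\<close>. The noise \<open>3 * k\<close> is left
    out because it determines the radius.\<close>
  let ?r = "case_sum (\<lambda>i. Inl (k, i)) (\<lambda>t. Inr (if t then 3 * k + 2 else 3 * k + 1))"
  have "inj ?r" by (auto simp: inj_on_def split: sum.splits if_splits)
  then have 1: "indep_vars (\<lambda>_. borel) (\<lambda>j. V (?r j)) UNIV"
    by (intro indep_vars_reindex[OF indep_V]) auto
  have 2: "(\<lambda>j. V (?r j)) = case_sum (\<lambda>i \<omega>. u k \<omega> $ i) (\<lambda>t. nu (if t then 3 * k + 2 else 3 * k + 1))"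
  proof
    show "V (?r j) = case_sum (\<lambda>i \<omega>. u k \<omega> $ i) (\<lambda>t. nu (if t then 3 * k + 2 else 3 * k + 1)) j" for j
      by (cases j) (simp_all add: V_simps)
  qed
  have 3: "indep_vars (\<lambda>_. borel) (\<lambda>i. V (Inl (k, i))) UNIV"
    by (rule indep_vars_reindex[OF indep_V]) (auto simp: inj_on_def)
  have 4: "expectation (nu j) = 0" "expectation (\<lambda>\<omega>. (nu j \<omega>)\<^sup>2) = \<sigma>\<^sup>2" for j
    using expectation_nu[of "\<lambda>t. t" j] expectation_nu[of "\<lambda>t. t\<^sup>2" j] mean0 second_moment by simp_all
  show ?thesis
  proof unfold_locales
    show "indep_vars (\<lambda>_. borel) (\<lambda>i \<omega>. u k \<omega> $ i) UNIV"
      using 3 by (simp only: V_simps)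
    show "indep_vars (\<lambda>_. borel) (case_sum (\<lambda>i \<omega>. u k \<omega> $ i) (\<lambda>t. nu (if t then 3 * k + 2 else 3 * k + 1))) UNIV"
      using 1 by (simp only: 2)
  qed (rule gauss bounded_nu 4)+
qed

text \<open>The radius is an argument instead of being computed from \<open>x\<close>, so that point
  and radius can be frozen while the fresh samples are averaged.\<close>

definition step :: "real^'n \<Rightarrow> real \<Rightarrow> real^'n \<Rightarrow> real \<Rightarrow> real \<Rightarrow> real^'n" where
  "step x \<mu> y s t = x - (h * (ftilde f (x + \<mu> *\<^sub>R y) s - ftilde f x t) / \<mu>) *\<^sub>R y"

text \<open>The linear term supplies the decrease \<open>2 * h * (f x - f z)\<close>, of which the
  gradient part of the quadratic term consumes at most one half. The exact moments are then relaxed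
  to the powers of \<open>n + 6\<close> and \<open>n + 4\<close> in which the constants are
  expressed.\<close>

lemma step_bound:
  fixes x :: "real^'n" and \<mu> :: real and k :: nat
  assumes mu: "0 < \<mu>"
  defines "n \<equiv> real CARD('n)"
  defines "S \<equiv> \<lambda>\<omega>. (norm (step x \<mu> (u k \<omega>) (nu (3 * k + 1) \<omega>) (nu (3 * k + 2) \<omega>) - z))\<^sup>2"
  shows "integrable M S"
    and "expectation S + h * (f x - f z) \<le> (norm (x - z))\<^sup>2
      + (h * L1 * n + h\<^sup>2 * L1\<^sup>2 * (n + 6) ^ 3 / 2) * \<mu>\<^sup>2 + 3 * h\<^sup>2 * \<sigma>\<^sup>2 * n * ((f x)\<^sup>2 / \<mu>\<^sup>2)
      + 3 * h\<^sup>2 * \<sigma>\<^sup>2 * L0\<^sup>2 * (n + 4)\<^sup>2"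
proof -
  interpret ng: noisy_gaussian M "u k" "\<lambda>t. nu (if t then 3 * k + 2 else 3 * k + 1)" a \<sigma>
    by (rule noisy_gaussian_step)
  define P where "P = expectation (\<lambda>\<omega>. f (x + \<mu> *\<^sub>R u k \<omega>) * (u k \<omega> \<bullet> (x - z)))"
  define Q where "Q = expectation (\<lambda>\<omega>. (norm (u k \<omega>))\<^sup>2 * ((f (x + \<mu> *\<^sub>R u k \<omega>) - f x)\<^sup>2
      + \<sigma>\<^sup>2 * ((f (x + \<mu> *\<^sub>R u k \<omega>))\<^sup>2 + (f x)\<^sup>2)))"
  have S: "S \<omega> = (norm ((x - z) - (h / \<mu> * (f (x + \<mu> *\<^sub>R u k \<omega>) * (1 + nu (if False then 3 * k + 2 else 3 * k + 1) \<omega>)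
      - f x * (1 + nu (if True then 3 * k + 2 else 3 * k + 1) \<omega>))) *\<^sub>R u k \<omega>))\<^sup>2" for \<omega>
    by (simp add: S_def step_def ftilde_def cancel_ab_semigroup_add_class.diff_right_commute[of x _ z])
  note growth = ng.poly_growth_f[OF grad lipf lipg]
  show "integrable M S"
    unfolding S[abs_def] by (rule ng.zo_step_expectation(1)[OF growth])
  have n: "0 \<le> n" by (simp add: n_def)
  \<comment> \<open>Scaling by \<open>h / \<mu>\<close> cancels the radius in the linear term and in
    all of the quadratic term except its \<open>(f x)^2\<close> part.\<close>
  have cancel: "2 * (h / \<mu>) * (\<mu> * T) = 2 * h * T" "(h / \<mu>)\<^sup>2 * (\<mu>\<^sup>2 * T + 3 * \<sigma>\<^sup>2 * (f x)\<^sup>2 * n) = h\<^sup>2 * T + 3 * h\<^sup>2 * \<sigma>\<^sup>2 * n * ((f x)\<^sup>2 / \<mu>\<^sup>2)" for T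
    using mu by (simp_all add: power_divide add_divide_distrib distrib_left)
  have "expectation S = (norm (x - z))\<^sup>2 - 2 * (h / \<mu>) * P + (h / \<mu>)\<^sup>2 * Q"
    unfolding S[abs_def] P_def Q_def by (rule ng.zo_step_expectation(2)[OF growth])
  also have "\<dots> \<le> (norm (x - z))\<^sup>2 - 2 * (h / \<mu>) * (\<mu> * (f x - f z - L1 / 2 * \<mu>\<^sup>2 * n))
      + (h / \<mu>)\<^sup>2 * (\<mu>\<^sup>2 * (2 * (n + 2) * (norm (g x))\<^sup>2 + \<mu>\<^sup>2 * L1\<^sup>2 / 2 * (n * (n + 2) * (n + 4))
        + 2 * \<sigma>\<^sup>2 * L0\<^sup>2 * (n * (n + 2))) + 3 * \<sigma>\<^sup>2 * (f x)\<^sup>2 * n)"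
    using ng.smoothed_gradient_inner[OF grad lipf lipg convex grad_cont mu, of x z]
      ng.smoothed_second_moment[OF grad lipf lipg mu, of x \<sigma>] h_pos mu
    unfolding P_def[symmetric] Q_def[symmetric] n_def[symmetric]
    by (intro add_mono diff_mono mult_left_mono) auto
  also have "\<dots> = (norm (x - z))\<^sup>2 - 2 * h * (f x - f z) + h * L1 * n * \<mu>\<^sup>2
      + h\<^sup>2 * (2 * (n + 2) * (norm (g x))\<^sup>2) + h\<^sup>2 * (\<mu>\<^sup>2 * L1\<^sup>2 / 2) * (n * (n + 2) * (n + 4))
      + h\<^sup>2 * (2 * \<sigma>\<^sup>2 * L0\<^sup>2) * (n * (n + 2)) + 3 * h\<^sup>2 * \<sigma>\<^sup>2 * n * ((f x)\<^sup>2 / \<mu>\<^sup>2)"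
    unfolding cancel by algebra
  finally have main: "expectation S \<le> \<dots>" .
  have "h\<^sup>2 * (2 * (n + 2) * (norm (g x))\<^sup>2) \<le> h\<^sup>2 * (2 * (n + 2) * (2 * L1 * (f x - f z)))"
    using norm_gradient_le_gap[OF grad lipg L1 minimizer, of x] n by (intro mult_left_mono) auto
  also have "\<dots> = (h * (4 * L1 * (n + 2))) * (h * (f x - f z))" by algebra
  also have "\<dots> \<le> 1 * (h * (f x - f z))"
  proof (rule mult_right_mono)
    \<comment> \<open>This is where the size of \<open>h\<close> matters:
      \<open>h * (4 * L1 * (n + 4))\<close> is exactly 1.\<close>
    have "h * (4 * L1 * (n + 2)) \<le> h * (4 * L1 * (n + 4))"
      using h_pos L1 by (intro mult_left_mono) auto
    also have "\<dots> = 1" using L1 n by (simp add: h n_def)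
    finally show "h * (4 * L1 * (n + 2)) \<le> 1" .
  qed (use h_pos minimizer[of x] in simp)
  finally have 1: "h\<^sup>2 * (2 * (n + 2) * (norm (g x))\<^sup>2) \<le> h * (f x - f z)" by simp
  have "n * (n + 2) * (n + 4) \<le> (n + 6) * (n + 6) * (n + 6)"
    using n by (intro mult_mono) auto
  then have 2: "h\<^sup>2 * (\<mu>\<^sup>2 * L1\<^sup>2 / 2) * (n * (n + 2) * (n + 4)) \<le> h\<^sup>2 * (\<mu>\<^sup>2 * L1\<^sup>2 / 2) * (n + 6) ^ 3"
    by (intro mult_left_mono) (auto simp: power3_eq_cube)
  have "n * (n + 2) \<le> (n + 4) * (n + 4)" using n by (intro mult_mono) auto
  then have "h\<^sup>2 * (2 * \<sigma>\<^sup>2 * L0\<^sup>2) * (n * (n + 2)) \<le> h\<^sup>2 * (3 * \<sigma>\<^sup>2 * L0\<^sup>2) * (n + 4)\<^sup>2"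
    using n by (intro mult_mono) (auto simp: power2_eq_square mult_right_mono)
  moreover have "(h * L1 * n + h\<^sup>2 * L1\<^sup>2 * (n + 6) ^ 3 / 2) * \<mu>\<^sup>2
      = h * L1 * n * \<mu>\<^sup>2 + h\<^sup>2 * (\<mu>\<^sup>2 * L1\<^sup>2 / 2) * (n + 6) ^ 3" by algebra
  moreover have "3 * h\<^sup>2 * \<sigma>\<^sup>2 * L0\<^sup>2 * (n + 4)\<^sup>2 = h\<^sup>2 * (3 * \<sigma>\<^sup>2 * L0\<^sup>2) * (n + 4)\<^sup>2" by simp
  ultimately show "expectation S + h * (f x - f z) \<le> (norm (x - z))\<^sup>2
      + (h * L1 * n + h\<^sup>2 * L1\<^sup>2 * (n + 6) ^ 3 / 2) * \<mu>\<^sup>2 + 3 * h\<^sup>2 * \<sigma>\<^sup>2 * n * ((f x)\<^sup>2 / \<mu>\<^sup>2)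
      + 3 * h\<^sup>2 * \<sigma>\<^sup>2 * L0\<^sup>2 * (n + 4)\<^sup>2"
    using main 1 2 by linarith
qed

text \<open>
  The iterate as a function of the coordinates it depends on. Since \<open>indep_var\<close> requires both
  variables to have the same value type, the past and the fresh samples are packed into functions on
  the common index type.
\<close>

definition past :: "nat \<Rightarrow> nat \<Rightarrow> (nat \<times> 'n + nat) set" where
  "past k m = Inl ` ({..<k} \<times> UNIV) \<union> Inr ` {..<m}"

definition X_of :: "nat \<Rightarrow> (nat \<times> 'n + nat \<Rightarrow> real) \<Rightarrow> real^'n" where
  "X_of k = zo_iter f h C4 x0 (\<lambda>j p. \<chi> i. p (Inl (j, i))) (\<lambda>j p. p (Inr j)) k"

text \<open>The bound \<open>m\<close> may exceed \<open>3 * k\<close>: it equals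
  \<open>3 * k\<close> when \<open>nu (3 * k)\<close> must be independent of the iterate, and
  \<open>3 * k + 1\<close> when that sample is counted with the past.\<close>

lemma X_of_restrict: "3 * k \<le> m \<Longrightarrow> X_of k (restrict (\<lambda>j. V j \<omega>) (past k m)) = X k \<omega>"
  unfolding X_of_def
  by (rule zo_iter_cong) (auto simp: past_def V_simps vec_eq_iff)

lemma measurable_X_of: "3 * k \<le> m \<Longrightarrow> X_of k \<in> borel_measurable (Pi\<^sub>M (past k m) (\<lambda>_. borel))"
  unfolding X_of_def
  by (intro borel_measurable_zo_iter measurable_f borel_measurable_vec_lambda measurable_component_singleton)
    (auto simp: past_def)

text \<open>Iterate \<open>k\<close> consumes only noises of index below \<open>3 * k\<close>, so
  the sample that fixes the radius is fresh. This factorizes the means of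
  \<open>|f x| * (1 + nu)\<close> and \<open>|f x| / (1 + nu)\<close>.\<close>

lemma indep_X_nu:
  fixes F :: "real^'n \<Rightarrow> real" and c :: "real \<Rightarrow> real"
  assumes F: "F \<in> borel_measurable borel" and c: "c \<in> borel_measurable borel"
  shows "indep_var borel (\<lambda>\<omega>. F (X k \<omega>)) borel (\<lambda>\<omega>. c (nu (3 * k) \<omega>))"
proof -
  have "indep_var borel ((\<lambda>p. F (X_of k p)) \<circ> (\<lambda>\<omega>. restrict (\<lambda>j. V j \<omega>) (past k (3 * k))))
      borel ((\<lambda>p. c (p (Inr (3 * k)))) \<circ> (\<lambda>\<omega>. restrict (\<lambda>j. V j \<omega>) {Inr (3 * k)}))"
  proof (rule indep_var_compose[OF indep_var_restrict[OF indep_V]])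
    show "(\<lambda>p. F (X_of k p)) \<in> borel_measurable (Pi\<^sub>M (past k (3 * k)) (\<lambda>_. borel))"
      by (rule measurable_compose[OF measurable_X_of F]) simp
    have "(\<lambda>p. p (Inr (3 * k))) \<in> Pi\<^sub>M {Inr (3 * k)} (\<lambda>_. borel) \<rightarrow>\<^sub>M (borel :: real measure)"
      by (rule measurable_component_singleton) simp
    from measurable_compose[OF this c]
    show "(\<lambda>p. c (p (Inr (3 * k)))) \<in> borel_measurable (Pi\<^sub>M {Inr (3 * k)} (\<lambda>_. borel))" .
  qed (auto simp: past_def)
  then show ?thesis by (simp add: comp_def X_of_restrict V_simps)
qed

lemma measurable_step [measurable (raw)]:
  assumes [measurable]: "x \<in> borel_measurable N" "m \<in> borel_measurable N" "y \<in> borel_measurable N"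
    "s \<in> borel_measurable N" "t \<in> borel_measurable N"
  shows "(\<lambda>\<omega>. step (x \<omega>) (m \<omega>) (y \<omega>) (s \<omega>) (t \<omega>)) \<in> borel_measurable N"
  unfolding step_def ftilde_def by measurable

text \<open>Conditioning on the past and on \<open>nu (3 * k)\<close>, written with two sample
  points: \<open>\<omega>\<close> fixes iterate and radius, \<open>\<omega>'\<close> supplies
  direction and noises. The nonnegative integral is essential, as integrability of the left side is
  only deduced from this identity.\<close>

lemma nn_integral_X_Suc:
  "(\<integral>\<^sup>+\<omega>. ennreal ((norm (X (Suc k) \<omega> - z))\<^sup>2) \<partial>M)
    = (\<integral>\<^sup>+\<omega>. (\<integral>\<^sup>+\<omega>'. ennreal ((norm (step (X k \<omega>) (zo_mu f C4 (X k \<omega>) (nu (3 * k) \<omega>))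
        (u k \<omega>') (nu (3 * k + 1) \<omega>') (nu (3 * k + 2) \<omega>') - z))\<^sup>2) \<partial>M) \<partial>M)"
proof -
  define A where "A = past k (3 * k + 1)"
  define \<Phi> where "\<Phi> r = ennreal ((norm (step (X_of k (fst r)) (zo_mu f C4 (X_of k (fst r)) (fst r (Inr (3 * k))))
    (\<chi> i. snd r (Inl (k, i))) (snd r (Inr (3 * k + 1))) (snd r (Inr (3 * k + 2))) - z))\<^sup>2)" for r
  have mem: "Inr (3 * k) \<in> A" "Inl (k, i) \<in> - A" "Inr (3 * k + 1) \<in> - A" "Inr (3 * k + 2) \<in> - A" for i
    by (auto simp: A_def past_def)
  let ?P = "Pi\<^sub>M A (\<lambda>_. borel :: real measure)" and ?Q = "Pi\<^sub>M (- A) (\<lambda>_. borel :: real measure)"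
  have indep: "indep_var ?P (\<lambda>\<omega>. restrict (\<lambda>j. V j \<omega>) A) ?Q (\<lambda>\<omega>. restrict (\<lambda>j. V j \<omega>) (- A))"
    by (rule indep_var_restrict[OF indep_V]) auto
  have [measurable]: "(\<lambda>r. X_of k (fst r)) \<in> borel_measurable (?P \<Otimes>\<^sub>M ?Q)"
    unfolding A_def by (rule measurable_compose[OF measurable_fst measurable_X_of]) simp
  have [measurable]: "(\<lambda>r. fst r (Inr (3 * k))) \<in> borel_measurable (?P \<Otimes>\<^sub>M ?Q)"
    by (rule measurable_compose[OF measurable_fst measurable_component_singleton]) (rule mem)
  have snd: "(\<lambda>r. snd r j) \<in> borel_measurable (?P \<Otimes>\<^sub>M ?Q)" if "j \<in> - A" for j
    by (rule measurable_compose[OF measurable_snd measurable_component_singleton]) (rule that)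
  note [measurable] = snd[OF mem(3)] snd[OF mem(4)]
  have [measurable]: "(\<lambda>r. \<chi> i. snd r (Inl (k, i))) \<in> borel_measurable (?P \<Otimes>\<^sub>M ?Q)"
    by (rule borel_measurable_vec_lambda) (rule snd[OF mem(2)])
  have \<Phi>: "\<Phi> \<in> borel_measurable (?P \<Otimes>\<^sub>M ?Q)"
    unfolding \<Phi>_def zo_mu_def ftilde_def by measurable
  have eq: "\<Phi> (restrict (\<lambda>j. V j \<omega>) A, restrict (\<lambda>j. V j \<omega>') (- A))
      = ennreal ((norm (step (X k \<omega>) (zo_mu f C4 (X k \<omega>) (nu (3 * k) \<omega>))
        (u k \<omega>') (nu (3 * k + 1) \<omega>') (nu (3 * k + 2) \<omega>') - z))\<^sup>2)" for \<omega> \<omega>'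
    using X_of_restrict[of k "3 * k + 1" \<omega>]
    by (simp only: \<Phi>_def fst_conv snd_conv restrict_apply' mem V_simps vec_lambda_eta A_def[symmetric]
        le_add1 simp_thms)
  have "X (Suc k) \<omega> = step (X k \<omega>) (zo_mu f C4 (X k \<omega>) (nu (3 * k) \<omega>))
        (u k \<omega>) (nu (3 * k + 1) \<omega>) (nu (3 * k + 2) \<omega>)" for \<omega>
    by (simp add: step_def Let_def)
  then show ?thesis
    using indep_var_nn_integral_iterated[OF indep \<Phi>] by (simp only: eq)
qed

section \<open>The recursion for the expected squared distance\<close>

lemma AE_noise_pos: "AE \<omega> in M. 1 - a \<le> 1 + nu j \<omega>"
  using bounded_nu[of j] by eventually_elim auto

lemma integrable_noise_factors:
  "integrable M (\<lambda>\<omega>. 1 + nu j \<omega>)" "integrable M (\<lambda>\<omega>. 1 / (1 + nu j \<omega>))"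
  "expectation (\<lambda>\<omega>. 1 + nu j \<omega>) = 1" "expectation (\<lambda>\<omega>. 1 / (1 + nu j \<omega>)) \<le> b"
proof -
  have i: "integrable M (nu j)"
    using bounded_nu[of j] by (intro integrable_const_bound[where B = a]) auto
  then show "integrable M (\<lambda>\<omega>. 1 + nu j \<omega>)" by simp
  show "expectation (\<lambda>\<omega>. 1 + nu j \<omega>) = 1"
    using i expectation_nu[of "\<lambda>t. t" j] mean0 by (simp add: prob_space)
  show "expectation (\<lambda>\<omega>. 1 / (1 + nu j \<omega>)) \<le> b"
    using expectation_nu[of "\<lambda>t. 1 / (1 + t)" j] inv_b by simp
  show "integrable M (\<lambda>\<omega>. 1 / (1 + nu j \<omega>))"
  proof (rule integrable_const_bound[where B = "1 / (1 - a)"])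
    show "AE \<omega> in M. norm (1 / (1 + nu j \<omega>)) \<le> 1 / (1 - a)"
      using AE_noise_pos[of j] by eventually_elim (use a in \<open>auto intro!: divide_left_mono mult_pos_pos\<close>)
  qed simp
qed

lemma b_nonneg: "0 \<le> b"
proof -
  have "0 \<le> expectation (\<lambda>\<omega>. 1 / (1 + nu 0 \<omega>))"
  proof (rule integral_nonneg_AE)
    show "AE \<omega> in M. 0 \<le> 1 / (1 + nu 0 \<omega>)"
      using AE_noise_pos[of 0] by eventually_elim (use a in auto)
  qed
  then show ?thesis using inv_b by linarith
qed

text \<open>Inserting \<open>\<mu>^2 = C4^2 * |f x| * (1 + v)\<close> into the fixed-radius bound
  leaves the random factors \<open>1 + v\<close> and \<open>1 / (1 + v)\<close>. Both are
  independent of the iterate, with mean 1 and mean at most \<open>b\<close>.\<close>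

lemma expectation_X_Suc:
  fixes k :: nat
  defines "n \<equiv> real CARD('n)"
  assumes int: "integrable M (\<lambda>\<omega>. (norm (X k \<omega> - z))\<^sup>2)"
  shows "integrable M (\<lambda>\<omega>. (norm (X (Suc k) \<omega> - z))\<^sup>2)"
    and "expectation (\<lambda>\<omega>. (norm (X (Suc k) \<omega> - z))\<^sup>2) + h * (expectation (\<lambda>\<omega>. f (X k \<omega>)) - f z)
      \<le> expectation (\<lambda>\<omega>. (norm (X k \<omega> - z))\<^sup>2)
        + ((h * L1 * n + h\<^sup>2 * L1\<^sup>2 * (n + 6) ^ 3 / 2) * C4\<^sup>2 + 3 * h\<^sup>2 * \<sigma>\<^sup>2 * n / C4\<^sup>2 * b)
          * expectation (\<lambda>\<omega>. \<bar>f (X k \<omega>)\<bar>)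
        + 3 * h\<^sup>2 * \<sigma>\<^sup>2 * L0\<^sup>2 * (n + 4)\<^sup>2"
proof -
  define \<alpha> where "\<alpha> = (h * L1 * n + h\<^sup>2 * L1\<^sup>2 * (n + 6) ^ 3 / 2) * C4\<^sup>2"
  define \<beta> where "\<beta> = 3 * h\<^sup>2 * \<sigma>\<^sup>2 * n / C4\<^sup>2"
  define \<gamma> where "\<gamma> = 3 * h\<^sup>2 * \<sigma>\<^sup>2 * L0\<^sup>2 * (n + 4)\<^sup>2"
  have n: "0 \<le> n" by (simp add: n_def)
  have \<beta>: "0 \<le> \<beta>" using n by (simp add: \<beta>_def)
  define F where "F \<omega> = \<bar>f (X k \<omega>)\<bar>" for \<omega>
  define v where "v = nu (3 * k)"
  define R where "R \<omega> = F \<omega> * (1 / (1 + v \<omega>))" for \<omega>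
  define I where "I \<omega> = (\<integral>\<^sup>+\<omega>'. ennreal ((norm (step (X k \<omega>) (zo_mu f C4 (X k \<omega>) (nu (3 * k) \<omega>))
        (u k \<omega>') (nu (3 * k + 1) \<omega>') (nu (3 * k + 2) \<omega>') - z))\<^sup>2) \<partial>M)" for \<omega>
  define W where "W \<omega> = (norm (X k \<omega> - z))\<^sup>2 - h * (f (X k \<omega>) - f z) + \<alpha> * (F \<omega> * (1 + v \<omega>))
    + \<beta> * R \<omega> + \<gamma>" for \<omega>
  \<comment> \<open>Only almost sure, since a positive radius needs a nonzero value of
    \<open>f\<close> and \<open>1 + v > 0\<close>. Nonnegativity of \<open>W\<close> is inherited
    from the mean of a square below it, and permits passing from the nonnegative integral to the
    expectation.\<close>
  have W: "AE \<omega> in M. I \<omega> \<le> ennreal (W \<omega>) \<and> 0 \<le> W \<omega>"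
    using nonzero[of k] AE_noise_pos[of "3 * k"]
  proof eventually_elim
    case (elim \<omega>)
    define x where "x = X k \<omega>"
    define \<mu> where "\<mu> = zo_mu f C4 x (nu (3 * k) \<omega>)"
    have pos: "0 < 1 + v \<omega>" "f x \<noteq> 0" using elim a by (auto simp: v_def x_def)
    then have mu: "0 < \<mu>" using C4 by (simp add: \<mu>_def zo_mu_def ftilde_def v_def)
    have mu2: "\<mu>\<^sup>2 = C4\<^sup>2 * (\<bar>f x\<bar> * (1 + v \<omega>))"
      using pos by (simp add: \<mu>_def zo_mu_def ftilde_def v_def power_mult_distrib abs_mult)
    have "t\<^sup>2 / (C4\<^sup>2 * (t * (1 + v \<omega>))) = t * (1 / (1 + v \<omega>)) / C4\<^sup>2" if "t \<noteq> 0" for t :: real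
      using that by (simp add: power2_eq_square)
    from this[of "\<bar>f x\<bar>"] have fmu: "(f x)\<^sup>2 / \<mu>\<^sup>2 = \<bar>f x\<bar> * (1 / (1 + v \<omega>)) / C4\<^sup>2"
      unfolding mu2 using pos by simp
    let ?S = "\<lambda>\<omega>'. (norm (step x \<mu> (u k \<omega>') (nu (3 * k + 1) \<omega>') (nu (3 * k + 2) \<omega>') - z))\<^sup>2"
    have I: "I \<omega> = ennreal (expectation ?S)"
      unfolding I_def x_def[symmetric] \<mu>_def[symmetric]
      by (rule nn_integral_eq_integral[OF step_bound(1)[OF mu]]) simp
    have le: "expectation ?S \<le> W \<omega>"
    proof -
      have "expectation ?S + h * (f x - f z) \<le> (norm (x - z))\<^sup>2
        + (h * L1 * n + h\<^sup>2 * L1\<^sup>2 * (n + 6) ^ 3 / 2) * \<mu>\<^sup>2 + 3 * h\<^sup>2 * \<sigma>\<^sup>2 * n * ((f x)\<^sup>2 / \<mu>\<^sup>2) + \<gamma>"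
        unfolding \<gamma>_def n_def by (rule step_bound(2)[OF mu])
      moreover have "(h * L1 * n + h\<^sup>2 * L1\<^sup>2 * (n + 6) ^ 3 / 2) * \<mu>\<^sup>2 = \<alpha> * (\<bar>f x\<bar> * (1 + v \<omega>))"
        unfolding mu2 \<alpha>_def by simp
      moreover have "3 * h\<^sup>2 * \<sigma>\<^sup>2 * n * ((f x)\<^sup>2 / \<mu>\<^sup>2) = \<beta> * (\<bar>f x\<bar> * (1 / (1 + v \<omega>)))"
        unfolding fmu \<beta>_def by simp
      ultimately show ?thesis unfolding W_def R_def F_def x_def[symmetric] by linarith
    qed
    have "0 \<le> expectation ?S" by simp
    from order_trans[OF this le] ennreal_leI[OF le] show ?case
      unfolding I by (rule conjI[rotated])
  qed
  have iF: "integrable M F" using integ[of k] by (simp add: F_def[abs_def])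
  have i1: "integrable M (\<lambda>\<omega>. F \<omega> * (1 + v \<omega>))" and e1: "expectation (\<lambda>\<omega>. F \<omega> * (1 + v \<omega>)) = expectation F"
  proof -
    have ind: "indep_var borel F borel (\<lambda>\<omega>. 1 + v \<omega>)"
      using indep_X_nu[of "\<lambda>x. \<bar>f x\<bar>" "\<lambda>t. 1 + t" k] by (simp add: F_def[abs_def] v_def)
    have iv: "integrable M (\<lambda>\<omega>. 1 + v \<omega>)" unfolding v_def by (rule integrable_noise_factors)
    show "integrable M (\<lambda>\<omega>. F \<omega> * (1 + v \<omega>))" by (rule indep_var_integrable[OF ind iF iv])
    show "expectation (\<lambda>\<omega>. F \<omega> * (1 + v \<omega>)) = expectation F"
      using indep_var_lebesgue_integral[OF ind iF iv] integrable_noise_factors(3)[of "3 * k"] by (simp add: v_def)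
  qed
  have i2: "integrable M R" and e2: "expectation R \<le> expectation F * b"
  proof -
    have ind: "indep_var borel F borel (\<lambda>\<omega>. 1 / (1 + v \<omega>))"
      using indep_X_nu[of "\<lambda>x. \<bar>f x\<bar>" "\<lambda>t. 1 / (1 + t)" k] by (simp add: F_def[abs_def] v_def)
    have iv: "integrable M (\<lambda>\<omega>. 1 / (1 + v \<omega>))" unfolding v_def by (rule integrable_noise_factors)
    show "integrable M R" unfolding R_def[abs_def] by (rule indep_var_integrable[OF ind iF iv])
    have "0 \<le> expectation F" by (simp add: F_def)
    then show "expectation R \<le> expectation F * b"
      unfolding R_def[abs_def] indep_var_lebesgue_integral[OF ind iF iv] unfolding v_def
      by (intro mult_left_mono integrable_noise_factors)
  qed
  have iW: "integrable M W"
    unfolding W_def[abs_def] using int integ[of k] i1 i2 by simp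
  have eW: "expectation W \<le> expectation (\<lambda>\<omega>. (norm (X k \<omega> - z))\<^sup>2) - h * (expectation (\<lambda>\<omega>. f (X k \<omega>)) - f z)
      + \<alpha> * expectation F + \<beta> * (expectation F * b) + \<gamma>"
  proof -
    have "expectation W = expectation (\<lambda>\<omega>. (norm (X k \<omega> - z))\<^sup>2) - h * (expectation (\<lambda>\<omega>. f (X k \<omega>)) - f z)
      + \<alpha> * expectation F + \<beta> * expectation R + \<gamma>"
      unfolding W_def[abs_def] e1[symmetric] using int integ[of k] i1 i2 by (simp add: prob_space)
    then show ?thesis using mult_left_mono[OF e2 \<beta>] by linarith
  qed
  have "(\<integral>\<^sup>+\<omega>. ennreal ((norm (X (Suc k) \<omega> - z))\<^sup>2) \<partial>M) = (\<integral>\<^sup>+\<omega>. I \<omega> \<partial>M)"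
    unfolding I_def by (rule nn_integral_X_Suc)
  also have "\<dots> \<le> (\<integral>\<^sup>+\<omega>. ennreal (W \<omega>) \<partial>M)"
    using W by (intro nn_integral_mono_AE) auto
  also have "\<dots> = ennreal (expectation W)"
    using W by (intro nn_integral_eq_integral iW) auto
  \<comment> \<open>A finite upper bound for the nonnegative integral: it yields integrability of
    the next squared distance as well as the inequality between expectations.\<close>
  finally have le: "(\<integral>\<^sup>+\<omega>. ennreal ((norm (X (Suc k) \<omega> - z))\<^sup>2) \<partial>M) \<le> ennreal (expectation W)" .
  have [measurable]: "X (Suc k) \<in> borel_measurable M" by (rule measurable_X)
  show i: "integrable M (\<lambda>\<omega>. (norm (X (Suc k) \<omega> - z))\<^sup>2)"
  proof (rule integrableI_nonneg)
    show "(\<integral>\<^sup>+\<omega>. ennreal ((norm (X (Suc k) \<omega> - z))\<^sup>2) \<partial>M) < \<infinity>"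
      using le by (rule order.strict_trans1) simp
  qed (simp_all del: zo_iter.simps)
  have "0 \<le> expectation W" using W by (intro integral_nonneg_AE) auto
  then have "expectation (\<lambda>\<omega>. (norm (X (Suc k) \<omega> - z))\<^sup>2) \<le> expectation W"
    using le nn_integral_eq_integral[OF i] by (simp del: zo_iter.simps)
  with eW show "expectation (\<lambda>\<omega>. (norm (X (Suc k) \<omega> - z))\<^sup>2) + h * (expectation (\<lambda>\<omega>. f (X k \<omega>)) - f z)
      \<le> expectation (\<lambda>\<omega>. (norm (X k \<omega> - z))\<^sup>2)
        + ((h * L1 * n + h\<^sup>2 * L1\<^sup>2 * (n + 6) ^ 3 / 2) * C4\<^sup>2 + 3 * h\<^sup>2 * \<sigma>\<^sup>2 * n / C4\<^sup>2 * b)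
          * expectation (\<lambda>\<omega>. \<bar>f (X k \<omega>)\<bar>)
        + 3 * h\<^sup>2 * \<sigma>\<^sup>2 * L0\<^sup>2 * (n + 4)\<^sup>2"
    unfolding \<alpha>_def[symmetric] \<beta>_def[symmetric] \<gamma>_def[symmetric] F_def[symmetric]
    by (simp only: distrib_right mult.assoc mult.commute[of b])
qed

text \<open>The induction keeps the last squared distance and its integrability, both needed for the
  next step, and drops the nonnegative distance only at the end. \<open>\<kappa>\<close> merely
  dominates the true coefficient because \<open>C7\<close> is larger than it.\<close>

lemma telescoped:
  fixes N :: nat and \<kappa> \<gamma> :: real
  assumes \<kappa>: "(h * L1 * real CARD('n) + h\<^sup>2 * L1\<^sup>2 * (real CARD('n) + 6) ^ 3 / 2) * C4\<^sup>2
      + 3 * h\<^sup>2 * \<sigma>\<^sup>2 * real CARD('n) / C4\<^sup>2 * b \<le> \<kappa>"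
    and \<gamma>: "3 * h\<^sup>2 * \<sigma>\<^sup>2 * L0\<^sup>2 * (real CARD('n) + 4)\<^sup>2 = \<gamma>"
  shows "h * (\<Sum>k<N. expectation (\<lambda>\<omega>. f (X k \<omega>)) - f z)
    \<le> (norm (x0 - z))\<^sup>2 + \<kappa> * (\<Sum>k<N. expectation (\<lambda>\<omega>. \<bar>f (X k \<omega>)\<bar>)) + real N * \<gamma>"
proof -
  have "integrable M (\<lambda>\<omega>. (norm (X N \<omega> - z))\<^sup>2) \<and>
    expectation (\<lambda>\<omega>. (norm (X N \<omega> - z))\<^sup>2) + h * (\<Sum>k<N. expectation (\<lambda>\<omega>. f (X k \<omega>)) - f z)
      \<le> (norm (x0 - z))\<^sup>2 + \<kappa> * (\<Sum>k<N. expectation (\<lambda>\<omega>. \<bar>f (X k \<omega>)\<bar>)) + real N * \<gamma>"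
  proof (induction N)
    case (Suc N)
    let ?e = "expectation (\<lambda>\<omega>. \<bar>f (X N \<omega>)\<bar>)"
    have "0 \<le> ?e" by simp
    from mult_right_mono[OF \<kappa> this] expectation_X_Suc(2)[OF conjunct1[OF Suc.IH]]
    have "expectation (\<lambda>\<omega>. (norm (X (Suc N) \<omega> - z))\<^sup>2) + h * (expectation (\<lambda>\<omega>. f (X N \<omega>)) - f z)
      \<le> expectation (\<lambda>\<omega>. (norm (X N \<omega> - z))\<^sup>2) + \<kappa> * ?e + \<gamma>"
      unfolding \<gamma> by linarith
    with Suc.IH expectation_X_Suc(1)[OF conjunct1[OF Suc.IH]] show ?case
      by (simp add: distrib_left distrib_right del: zo_iter.simps)
  qed (simp add: prob_space)
  moreover have "0 \<le> expectation (\<lambda>\<omega>. (norm (X N \<omega> - z))\<^sup>2)" by simp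
  ultimately show ?thesis by linarith
qed

end

section \<open>Evaluation of the constants and the averaged bound\<close>

theorem theorem4:
  fixes M :: "'w measure"
    and f :: "real^'n \<Rightarrow> real" and g :: "real^'n \<Rightarrow> real^'n"
    and L0 L1 a b \<sigma>r h C4 C5 C6 C7 C8 n Mb :: real
    and xstar x0 :: "real^'n"
    and u :: "nat \<Rightarrow> 'w \<Rightarrow> real^'n" and nu :: "nat \<Rightarrow> 'w \<Rightarrow> real"
    and N :: nat
  defines "n \<equiv> real CARD('n)"
  defines "C4 \<equiv> root 4 (16 * \<sigma>r\<^sup>2 * n / (L1\<^sup>2 * (1 + 3 * \<sigma>r\<^sup>2) * (n + 6) ^ 3))"
  defines "h \<equiv> 1 / (4 * L1 * (n + 4))"
  defines "C5 \<equiv> 1/2 * C4\<^sup>2 * L1\<^sup>2 * (n + 6) ^ 3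
                 + (1 + b) * L1 * \<sigma>r * sqrt ((1 + 3 * \<sigma>r\<^sup>2) * n * (n + 6) ^ 3)"
  defines "C6 \<equiv> 3 * L0\<^sup>2 * \<sigma>r\<^sup>2 * (n + 4)\<^sup>2"
  defines "C7 \<equiv> C4\<^sup>2 * n / (4 * (n + 4)) + C5 / (16 * L1\<^sup>2 * (n + 4)\<^sup>2)"
  defines "C8 \<equiv> C6 / (16 * L1\<^sup>2 * (n + 4)\<^sup>2)"
  assumes P: "prob_space M"
    (* f convex, C^1 with gradient g, Lipschitz with L0, gradient Lipschitz with L1 *)
    and convex: "convex_on UNIV f"
    and grad: "\<And>x. (f has_derivative (\<lambda>d. g x \<bullet> d)) (at x)"
    and grad_cont: "continuous_on UNIV g"
    and L1pos: "L1 > 0"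
    and lipf: "\<And>x y. \<bar>f x - f y\<bar> \<le> L0 * norm (x - y)"
    and lipg: "\<And>x y. norm (g x - g y) \<le> L1 * norm (x - y)"
    and minimizer: "\<And>x. f xstar \<le> f x"
    (* all noise samples and all Gaussian coordinates are mutually independent *)
    and indep: "prob_space.indep_vars M (\<lambda>_. borel)
                  (case_sum (\<lambda>(k, i) \<omega>. u k \<omega> $ i) nu) UNIV"
    (* u k is a standard Gaussian vector: i.i.d. N(0,1) coordinates *)
    and gauss: "\<And>k i. distributed M lborel (\<lambda>\<omega>. u k \<omega> $ i) std_normal_density"
    (* noise identically distributed *)
    and ident: "\<And>j. distr M borel (nu j) = distr M borel (nu 0)"
    and a_lt: "a < 1"
    and support: "AE \<omega> in M. \<bar>nu 0 \<omega>\<bar> \<le> a"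
    and mean0: "prob_space.expectation M (nu 0) = 0"
    and var: "prob_space.variance M (nu 0) = \<sigma>r\<^sup>2"
    and sigpos: "\<sigma>r > 0"
    and inv_b: "prob_space.expectation M (\<lambda>\<omega>. 1 / (1 + nu 0 \<omega>)) \<le> b"
    (* f(x_k) \<noteq> 0 along the iterates, so that mu_k > 0 *)
    and nonzero: "\<And>k. AE \<omega> in M. f (zo_iter f h C4 x0 u nu k \<omega>) \<noteq> 0"
    (* the expectations E[f(x_k)] exist *)
    and integ: "\<And>k. integrable M (\<lambda>\<omega>. f (zo_iter f h C4 x0 u nu k \<omega>))"
    and Mbound: "Mb \<ge> (\<bar>f x0\<bar> + (\<Sum>k=1..N. prob_space.expectation M
                      (\<lambda>\<omega>. \<bar>f (zo_iter f h C4 x0 u nu k \<omega>)\<bar>))) / (real N + 1)"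
  shows "(\<Sum>k=0..N. (if k = 0 then f x0
            else prob_space.expectation M (\<lambda>\<omega>. f (zo_iter f h C4 x0 u nu k \<omega>))) - f xstar)
           / (real N + 1)
         \<le> 4 * L1 * (n + 4) / (real N + 1) * (norm (x0 - xstar))\<^sup>2
            + 4 * L1 * (n + 4) * (C7 * Mb + C8)"
proof -
  interpret prob_space M by (rule P)
  have n: "1 \<le> n" by (simp add: n_def Suc_le_eq)
  define q where "q = sqrt ((1 + 3 * \<sigma>r\<^sup>2) * n * (n + 6) ^ 3)"
  have "0 < 1 + 3 * \<sigma>r\<^sup>2" by (rule add_pos_nonneg) auto
  then have q2: "q\<^sup>2 = (1 + 3 * \<sigma>r\<^sup>2) * n * (n + 6) ^ 3" and q: "0 < q"
    using n by (auto simp: q_def)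
  define y where "y = 16 * \<sigma>r\<^sup>2 * n / (L1\<^sup>2 * (1 + 3 * \<sigma>r\<^sup>2) * (n + 6) ^ 3)"
  have y: "0 < y"
    using n sigpos L1pos \<open>0 < 1 + 3 * \<sigma>r\<^sup>2\<close> by (auto simp: y_def)
  then have C4: "0 < C4" by (simp add: C4_def flip: y_def)
  \<comment> \<open>The recursion involves the fourth root only through its square; extending the
    fraction by \<open>n\<close> makes \<open>q^2\<close> appear in the denominator.\<close>
  have C4_sq: "C4\<^sup>2 = 4 * \<sigma>r * n / (L1 * q)"
  proof (rule power2_eq_imp_eq)
    have "(C4\<^sup>2)\<^sup>2 = C4 ^ 4" by (simp flip: power_mult)
    also have "\<dots> = y" using y by (simp add: C4_def flip: y_def)
    also have "\<dots> = (4 * \<sigma>r * n / (L1 * q))\<^sup>2"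
    proof -
      have "16 * s * n / (l * p * r) = 4\<^sup>2 * s * n\<^sup>2 / (l * (p * n * r))" for s l p r :: real
        using n by (simp add: power2_eq_square)
      then show ?thesis unfolding power_divide power_mult_distrib q2 y_def .
    qed
    finally show "(C4\<^sup>2)\<^sup>2 = (4 * \<sigma>r * n / (L1 * q))\<^sup>2" .
  qed (use sigpos n L1pos q in auto)
  have sec: "expectation (\<lambda>\<omega>. (nu 0 \<omega>)\<^sup>2) = \<sigma>r\<^sup>2" using var mean0 by simp
  interpret zo_process M f g L0 L1 a b \<sigma>r h C4 xstar x0 u nu
    by (rule zo_process.intro[OF P zo_process_axioms.intro[OF convex grad grad_cont L1pos lipf lipg
        minimizer indep gauss ident a_lt support mean0 sec inv_b _ C4 nonzero integ]])
      (simp_all add: h_def n_def)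
  have b: "0 \<le> b" by (rule b_nonneg)
  have h2: "h\<^sup>2 = 1 / (16 * L1\<^sup>2 * (n + 4)\<^sup>2)" by (simp add: h_def power_divide power_mult_distrib)
  have C5: "C5 = 1/2 * C4\<^sup>2 * L1\<^sup>2 * (n + 6) ^ 3 + (1 + b) * L1 * \<sigma>r * q"
    by (simp add: C5_def q_def)
  have C7: "C7 = h * L1 * n * C4\<^sup>2 + h\<^sup>2 * C5"
    using L1pos n by (simp add: C7_def h2) (simp add: h_def)
  have C8: "3 * h\<^sup>2 * \<sigma>r\<^sup>2 * L0\<^sup>2 * (n + 4)\<^sup>2 = C8" by (simp add: C8_def C6_def h2)
  have C7_ge: "(h * L1 * n + h\<^sup>2 * L1\<^sup>2 * (n + 6) ^ 3 / 2) * C4\<^sup>2 + 3 * h\<^sup>2 * \<sigma>r\<^sup>2 * n / C4\<^sup>2 * b \<le> C7"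
  proof -
    \<comment> \<open>By the choice of \<open>C4\<close>, the inverse square turns into a multiple
      of \<open>L1 * \<sigma>r * q\<close>, the second summand of \<open>C5\<close>; the first
      summand is the remainder term without change.\<close>
    have "3 * \<sigma>r\<^sup>2 * n / C4\<^sup>2 * b = 3 / 4 * (b * (L1 * \<sigma>r * q))"
      unfolding C4_sq using sigpos n L1pos q by (simp add: field_simps power2_eq_square)
    also have "\<dots> \<le> (1 + b) * (L1 * \<sigma>r * q)"
      using b sigpos L1pos q by (simp add: distrib_right)
    finally have "h\<^sup>2 * (3 * \<sigma>r\<^sup>2 * n / C4\<^sup>2 * b) \<le> h\<^sup>2 * ((1 + b) * (L1 * \<sigma>r * q))"
      by (rule mult_left_mono) simp
    then show ?thesis unfolding C7 C5 by (simp add: algebra_simps)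
  qed
  \<comment> \<open>\<open>Mb\<close> only bounds the average of \<open>|f|\<close> from above, so
    replacing that average needs a nonnegative coefficient.\<close>
  have C7_nonneg: "0 \<le> C7"
    unfolding C7 C5 using h_pos L1pos n b sigpos q by (intro add_nonneg_nonneg mult_nonneg_nonneg) auto
  let ?E = "\<lambda>k. expectation (\<lambda>\<omega>. f (zo_iter f h C4 x0 u nu k \<omega>))"
  let ?A = "\<lambda>k. expectation (\<lambda>\<omega>. \<bar>f (zo_iter f h C4 x0 u nu k \<omega>)\<bar>)"
  have "(\<Sum>k<Suc N. ?A k) = \<bar>f x0\<bar> + (\<Sum>k=1..N. ?A k)"
    by (simp add: sum.lessThan_Suc_shift sum.atLeast1_atMost_eq prob_space del: zo_iter.simps(2) sum.lessThan_Suc)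
  then have A: "(\<Sum>k<Suc N. ?A k) \<le> (real N + 1) * Mb"
    using Mbound by (simp add: field_simps)
  have "h * (\<Sum>k<Suc N. ?E k - f xstar)
      \<le> (norm (x0 - xstar))\<^sup>2 + C7 * (\<Sum>k<Suc N. ?A k) + real (Suc N) * C8"
    using C7_ge C8 by (intro telescoped) (simp_all add: n_def)
  also have "\<dots> \<le> (norm (x0 - xstar))\<^sup>2 + C7 * ((real N + 1) * Mb) + real (Suc N) * C8"
    by (intro add_mono mult_left_mono A C7_nonneg order_refl)
  also have "\<dots> = (norm (x0 - xstar))\<^sup>2 + (real N + 1) * (C7 * Mb + C8)"
    by (simp add: algebra_simps)
  finally have main: "h * (\<Sum>k<Suc N. ?E k - f xstar) \<le> \<dots>" .
  have inv_h: "4 * L1 * (n + 4) * h = 1" using L1pos n by (simp add: h_def)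
  have "(\<Sum>k<Suc N. ?E k - f xstar) = 4 * L1 * (n + 4) * (h * (\<Sum>k<Suc N. ?E k - f xstar))"
    unfolding mult.assoc[symmetric] inv_h by simp
  also have "\<dots> \<le> 4 * L1 * (n + 4) * ((norm (x0 - xstar))\<^sup>2 + (real N + 1) * (C7 * Mb + C8))"
    using main L1pos n by (intro mult_left_mono) auto
  finally have "(\<Sum>k<Suc N. ?E k - f xstar) / (real N + 1)
      \<le> 4 * L1 * (n + 4) * ((norm (x0 - xstar))\<^sup>2 + (real N + 1) * (C7 * Mb + C8)) / (real N + 1)"
    by (intro divide_right_mono) auto
  also have "\<dots> = 4 * L1 * (n + 4) / (real N + 1) * (norm (x0 - xstar))\<^sup>2 + 4 * L1 * (n + 4) * (C7 * Mb + C8)"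
  proof -
    have "K * (s + r * t) / r = K / r * s + K * t" if "r \<noteq> 0" for K s r t :: real
      using that by (simp add: field_simps)
    then show ?thesis by simp
  qed
  \<comment> \<open>At \<open>k = 0\<close> the iterate is the constant \<open>x0\<close>, whose
    expectation over a probability space is \<open>f x0\<close>.\<close>
  also have "(\<Sum>k<Suc N. ?E k - f xstar) = (\<Sum>k=0..N. (if k = 0 then f x0 else ?E k) - f xstar)"
    by (rule sum.cong) (auto simp: prob_space)
  finally show ?thesis .
qed

end
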